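(* For $v\in L^2_{\mathbb{C}}(0,1)$, $\overline{v}(1-x)=v(x)$, $\|v\|=1$, the non-local potential $\{\alpha,v\}$ can be recovered by the three spectra $\sigma(L_0)$, $\sigma(L_\alpha(v))$ and $\sigma(L_\alpha(v+h))$, where $h(x)=(x-\tfrac12)^2$.
   Context: Throughout, $\alpha\in\mathbb{R}$, and $\langle f,g\rangle=\int_0^1 f(x)\overline{g(x)}\,dx$, $\|f\|=\langle f,f\rangle^{1/2}$ on $L^2_{\mathbb{C}}(0,1)$. For $v\in L^2_{\mathbb{C}}(0,1)$, the self-adjoint operator $L_\alpha(v)$ in $L^2_{\mathbb{C}}(0,1)$ is $(L_\alpha(v)y)(x)=\mathrm{i}y'''(x)+\alpha\langle y,v\rangle v(x)$ with domain $\{y\in W_3^2(0,1): y(1)=y(0),\ y'(1)=y'(0),\ y''(1)=y''(0)\}$, where $W_3^2(0,1)$ is the Sobolev space of functions with three derivatives in $L^2$; $L_0$ is the operator $L_0y=\mathrm{i}y'''$ with the same domain. $\sigma(\cdot)$ denotes the spectrum, and $\overline{v}$ is the complex conjugate of $v$.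
   Formalization: For α = 0 all three operators equal L_0 whatever v is, so v cannot be recovered; the formal theorem recovers α always and v (almost everywhere) when α ≠ 0. The spectra are taken as eigenvalues counted with multiplicity. *)

theory Defs
  imports "HOL-Analysis.Analysis" "HOL-Library.Function_Algebras"
begin

text \<open>Elements of $L^2_{\mathbb{C}}(0,1)$ are represented by functions on the reals, to be compared
  almost everywhere on $(0,1)$; their values outside the interval play no role.\<close>

abbreviation I01 :: "real measure" where
  "I01 \<equiv> lebesgue_on {0<..<1}"

definition L2 :: "(real \<Rightarrow> complex) set" where
  "L2 = {f. f \<in> borel_measurable I01 \<and> integrable I01 (\<lambda>x. (cmod (f x))\<^sup>2)}"

definition L2_inner :: "(real \<Rightarrow> complex) \<Rightarrow> (real \<Rightarrow> complex) \<Rightarrow> complex" where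
  "L2_inner f g = (\<integral>x. f x * cnj (g x) \<partial>I01)"

definition L2_norm :: "(real \<Rightarrow> complex) \<Rightarrow> real" where
  "L2_norm f = sqrt (Re (L2_inner f f))"

text \<open>\<open>sobolev_deriv y g\<close>: on $[0,1]$, \<open>y\<close> is an absolutely continuous function with derivative
  $g\in L^2(0,1)$, i.e. it is the continuous representative of an element of the first order Sobolev
  space with weak derivative \<open>g\<close>. In a chain of such derivatives all members but the last one are
  thus continuous on $[0,1]$, so that their boundary values make sense.\<close>

definition sobolev_deriv :: "(real \<Rightarrow> complex) \<Rightarrow> (real \<Rightarrow> complex) \<Rightarrow> bool" where
  "sobolev_deriv y g \<longleftrightarrow> g \<in> L2 \<and>
     (\<forall>x\<in>{0..1}. y x = y 0 + (\<integral>t. g t \<partial>lebesgue_on {0..x}))"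

text \<open>An unbounded operator in $L^2$ is given by its graph, a set of pairs $(y, Ty)$. The first
  component is the continuous representative on $[0,1]$, extended by zero, which makes it unique as
  a function; the second component ranges over all representatives of $Ty$.\<close>

type_synonym l2_operator = "((real \<Rightarrow> complex) \<times> (real \<Rightarrow> complex)) set"

definition op_L0 :: l2_operator where
  "op_L0 = {(y, w). \<exists>y1 y2 y3.
     sobolev_deriv y y1 \<and> sobolev_deriv y1 y2 \<and> sobolev_deriv y2 y3 \<and>
     y 1 = y 0 \<and> y1 1 = y1 0 \<and> y2 1 = y2 0 \<and>
     (\<forall>x. x \<notin> {0..1} \<longrightarrow> y x = 0) \<and>
     w \<in> L2 \<and> (AE x in I01. w x = \<i> * y3 x)}"

definition op_L :: "real \<Rightarrow> (real \<Rightarrow> complex) \<Rightarrow> l2_operator" where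
  "op_L \<alpha> v = {(y, w). \<exists>z. (y, z) \<in> op_L0 \<and> w \<in> L2 \<and>
     (AE x in I01. w x = z x + of_real \<alpha> * L2_inner y v * v x)}"

definition resolvent_set :: "l2_operator \<Rightarrow> complex set" where
  "resolvent_set T = {\<mu>.
     (\<forall>f\<in>L2. \<exists>!y. \<exists>w. (y, w) \<in> T \<and> (AE x in I01. w x - \<mu> * y x = f x)) \<and>
     (\<exists>C. \<forall>(y, w)\<in>T. L2_norm y \<le> C * L2_norm (\<lambda>x. w x - \<mu> * y x))}"

definition spectrum :: "l2_operator \<Rightarrow> complex set" where
  "spectrum T = - resolvent_set T"

definition eigenspace :: "l2_operator \<Rightarrow> complex \<Rightarrow> (real \<Rightarrow> complex) set" where
  "eigenspace T \<mu> = {y. \<exists>w. (y, w) \<in> T \<and> (AE x in I01. w x = \<mu> * y x)}"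

definition fun_scale :: "complex \<Rightarrow> (real \<Rightarrow> complex) \<Rightarrow> (real \<Rightarrow> complex)" where
  "fun_scale c f = (\<lambda>x. c * f x)"

lemma vector_space_fun_scale: "vector_space fun_scale"
  by unfold_locales (auto simp: fun_scale_def fun_eq_iff algebra_simps)

definition multiplicity_of :: "l2_operator \<Rightarrow> complex \<Rightarrow> nat" where
  "multiplicity_of T \<mu> = vector_space.dim fun_scale (eigenspace T \<mu>)"

text \<open>In the inverse problem a spectrum is given with its multiplicities: it consists of
  eigenvalues, each repeated according to the dimension of its eigenspace. Here this is encoded as
  the set of points of the spectrum paired with their multiplicities.\<close>

definition counted_spectrum :: "l2_operator \<Rightarrow> (complex \<times> nat) set" where
  "counted_spectrum T = {(\<mu>, multiplicity_of T \<mu>) | \<mu>. \<mu> \<in> spectrum T}"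

end

theory Submission
  imports Defs "HOL-Complex_Analysis.Complex_Analysis"
begin

text \<open>The eigenvalues of \<open>L\<^sub>0\<close> are the numbers \<open>\<lambda>\<^sub>n = (2 \<pi> n)\<^sup>3\<close> with eigenfunctions
  \<open>exp (2 \<pi> i n x)\<close>, and \<open>L\<^sub>\<alpha>(v)\<close> is a perturbation of \<open>L\<^sub>0\<close> of rank one with characteristic function
  \<open>F \<mu> = 1 + \<alpha> (\<Sum>n. \<bar>v\<^sub>n\<bar>\<^sup>2 / (\<lambda>\<^sub>n - \<mu>))\<close>, where \<open>v\<^sub>n\<close> are the Fourier coefficients of \<open>v\<close>.
  The eigenvalue multiplicities of \<open>L\<^sub>\<alpha>(v)\<close> determine the poles of \<open>F\<close> and its zeros, and the quotient of
  two such functions with the same poles and zeros is an entire function that omits two values and tends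
  to 1 along the imaginary axis, hence is 1. Thus the spectrum determines the residues \<open>\<alpha> \<bar>v\<^sub>n\<bar>\<^sup>2\<close>, and
  their sum \<open>\<alpha>\<close> by Parseval. By the symmetry of \<open>v\<close> and \<open>h\<close> all \<open>v\<^sub>n\<close> and \<open>h\<^sub>n\<close> are real, and \<open>h\<^sub>n \<noteq> 0\<close>, so
  for \<open>\<alpha> \<noteq> 0\<close> the numbers \<open>\<alpha> v\<^sub>n\<^sup>2\<close> and \<open>\<alpha> (v\<^sub>n + h\<^sub>n)\<^sup>2\<close> determine \<open>v\<^sub>n\<close>.\<close>

section \<open>The Hilbert space and its Fourier coefficients\<close>

text \<open>An index with \<open>\<alpha> v_n = 0\<close> is invisible to \<open>F\<close>: its
  eigenvalue survives the perturbation and may even coincide with a zero of \<open>F\<close>.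
  Multiplicities resolve this. At an active point, where \<open>\<alpha> v_n \<noteq> 0\<close>, the
  multiplicity is 0; at any other \<open>\<mu>\<close> it is 1 for a zero of \<open>F\<close> plus 1
  for an eigenvalue of the unperturbed operator. So active and inactive points, and zeros hidden
  behind inactive points, can be told apart. The comparison of two characteristic functions rests on
  a sign. All residues carry the sign of \<open>\<alpha>\<close>; unless all of them vanish,
  \<open>F\<close> is therefore not real off the real axis and its zeros are real and simple, which
  is why common zeros and poles cancel exactly in the quotient. For \<open>\<alpha> = 0\<close> the
  operator does not depend on \<open>v\<close> at all, so that only \<open>\<alpha>\<close> can be
  recovered.\<close>

interpretation I01: finite_measure I01
  by (rule finite_measure_lebesgue_on) simp

lemma measure_I01 [simp]: "measure I01 {0<..<1} = 1" "measure I01 (space I01) = 1"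
  by (simp_all add: measure_restrict_space)

lemma measurable_I01_continuous:
  fixes f :: "real \<Rightarrow> 'a::topological_space"
  assumes "continuous_on {0..1} f"
  shows "f \<in> borel_measurable I01"
  using assms by (intro continuous_imp_measurable_on_sets_lebesgue)
    (auto elim: continuous_on_subset)

lemma integrable_I01_bounded:
  fixes f :: "real \<Rightarrow> 'a::{banach, second_countable_topology}"
  assumes "f \<in> borel_measurable I01" "\<And>x. x \<in> {0<..<1} \<Longrightarrow> norm (f x) \<le> B"
  shows "integrable I01 f"
  using assms by (intro I01.integrable_const_bound[where B=B]) auto

lemma bounded_on_unit_interval:
  fixes f :: "real \<Rightarrow> 'a::real_normed_vector"
  assumes "continuous_on {0..1} f"
  obtains B where "B > 0" "\<And>x. x \<in> {0..1} \<Longrightarrow> norm (f x) \<le> B"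
proof -
  have "bounded (f ` {0..1})"
    using assms compact_continuous_image compact_imp_bounded by blast
  then show ?thesis using that unfolding bounded_pos by auto
qed

lemma integrable_I01_continuous:
  fixes f :: "real \<Rightarrow> 'a::{banach, second_countable_topology}"
  assumes "continuous_on {0..1} f"
  shows "integrable I01 f"
proof -
  obtain B where B: "\<And>x. x \<in> {0..1} \<Longrightarrow> norm (f x) \<le> B"
    using bounded_on_unit_interval[OF assms] by blast
  show ?thesis
    by (rule integrable_I01_bounded[where B=B]) (use assms B in \<open>auto intro: measurable_I01_continuous\<close>)
qed

lemma integral_I01_eq:
  fixes f :: "real \<Rightarrow> 'a::euclidean_space"
  assumes "integrable I01 f"
  shows "(\<integral>x. f x \<partial>I01) = integral {0..1} f"
  using assms by (simp add: lebesgue_integral_eq_integral integral_open_interval_real)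

lemma integral_I01_FTC:
  fixes f F :: "real \<Rightarrow> 'a::euclidean_space"
  assumes "continuous_on {0..1} f"
    and "\<And>x. x \<in> {0..1} \<Longrightarrow> (F has_vector_derivative f x) (at x within {0..1})"
  shows "(\<integral>x. f x \<partial>I01) = F 1 - F 0"
proof -
  have "(f has_integral (F 1 - F 0)) {0..1}"
    by (rule fundamental_theorem_of_calculus) (use assms in auto)
  then show ?thesis
    using assms(1) by (simp add: integral_I01_eq integrable_I01_continuous integral_unique)
qed

lemma cnj_measurable [measurable]: "cnj \<in> borel_measurable borel"
  by (intro borel_measurable_continuous_onI continuous_intros)

lemma L2_measurable [measurable_dest]: "f \<in> L2 \<Longrightarrow> f \<in> borel_measurable I01"
  by (simp add: L2_def)

lemma L2_norm_integrable: "f \<in> L2 \<Longrightarrow> integrable I01 (\<lambda>x. (cmod (f x))\<^sup>2)"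
  by (simp add: L2_def)

lemma L2_bounded:
  assumes "f \<in> borel_measurable I01" "\<And>x. x \<in> {0<..<1} \<Longrightarrow> cmod (f x) \<le> B"
  shows "f \<in> L2"
proof -
  have "norm ((cmod (f x))\<^sup>2) \<le> B\<^sup>2" if "x \<in> {0<..<1}" for x
    using assms(2)[OF that] by (simp add: power_mono)
  then have "integrable I01 (\<lambda>x. (cmod (f x))\<^sup>2)"
    using assms(1) by (intro integrable_I01_bounded[where B="B\<^sup>2"]) auto
  then show ?thesis using assms(1) by (simp add: L2_def)
qed

lemma L2_continuous:
  assumes "continuous_on {0..1} f" shows "f \<in> L2"
proof -
  obtain B where "\<And>x. x \<in> {0..1} \<Longrightarrow> norm (f x) \<le> B"
    using bounded_on_unit_interval[OF assms] by blast
  then show ?thesis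
    by (intro L2_bounded[where B=B] measurable_I01_continuous assms) auto
qed

lemma norm_sum_square_le: "(cmod (a + b))\<^sup>2 \<le> 2 * (cmod a)\<^sup>2 + 2 * (cmod b)\<^sup>2"
proof -
  have "(cmod (a + b))\<^sup>2 \<le> (cmod a + cmod b)\<^sup>2"
    by (simp add: norm_triangle_ineq power_mono)
  also have "\<dots> \<le> 2 * (cmod a)\<^sup>2 + 2 * (cmod b)\<^sup>2"
    using zero_le_power2[of "cmod a - cmod b"] unfolding power2_sum power2_diff by linarith
  finally show ?thesis .
qed

lemma L2_add: assumes "f \<in> L2" "g \<in> L2" shows "(\<lambda>x. f x + g x) \<in> L2"
proof -
  have "integrable I01 (\<lambda>x. (cmod (f x + g x))\<^sup>2)"
  proof (rule Bochner_Integration.integrable_bound)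
    show "integrable I01 (\<lambda>x. 2 * (cmod (f x))\<^sup>2 + 2 * (cmod (g x))\<^sup>2)"
      using assms by (simp add: L2_def)
    show "AE x in I01. norm ((cmod (f x + g x))\<^sup>2) \<le> norm (2 * (cmod (f x))\<^sup>2 + 2 * (cmod (g x))\<^sup>2)"
      using norm_sum_square_le by (simp add: abs_of_nonneg)
  qed (use assms[THEN L2_measurable] in measurable)
  then show ?thesis using assms by (auto simp: L2_def)
qed

lemma L2_scale: "f \<in> L2 \<Longrightarrow> (\<lambda>x. c * f x) \<in> L2"
  by (auto simp: L2_def norm_mult power_mult_distrib)

lemma L2_diff: assumes "f \<in> L2" "g \<in> L2" shows "(\<lambda>x. f x - g x) \<in> L2"
  using L2_add[OF assms(1) L2_scale[OF assms(2), of "-1"]] by simp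

lemma L2_zero: "(\<lambda>x. 0) \<in> L2"
  by (simp add: L2_def)

lemma L2_sum: "finite A \<Longrightarrow> (\<And>i. i \<in> A \<Longrightarrow> f i \<in> L2) \<Longrightarrow> (\<lambda>x. \<Sum>i\<in>A. f i x) \<in> L2"
  by (induction A rule: finite_induct) (auto intro: L2_zero L2_add)

lemma L2_inner_integrable:
  assumes "f \<in> L2" "g \<in> L2" shows "integrable I01 (\<lambda>x. f x * cnj (g x))"
proof (rule Bochner_Integration.integrable_bound)
  show "integrable I01 (\<lambda>x. (cmod (f x))\<^sup>2 + (cmod (g x))\<^sup>2)"
    using assms by (simp add: L2_def)
  have "cmod (f x) * cmod (g x) \<le> (cmod (f x))\<^sup>2 + (cmod (g x))\<^sup>2" for x
    using sum_squares_bound[of "cmod (f x)" "cmod (g x)"]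
      mult_nonneg_nonneg[OF norm_ge_zero[of "f x"] norm_ge_zero[of "g x"]]
    by linarith
  then show "AE x in I01. norm (f x * cnj (g x)) \<le> norm ((cmod (f x))\<^sup>2 + (cmod (g x))\<^sup>2)"
    by (simp add: norm_mult)
qed (use assms[THEN L2_measurable] in measurable)

lemma L2_integrable: assumes "f \<in> L2" shows "integrable I01 f"
  using L2_inner_integrable[OF assms L2_continuous[of "\<lambda>_. 1"]] by simp

lemma L2_inner_add_left: "f \<in> L2 \<Longrightarrow> g \<in> L2 \<Longrightarrow> k \<in> L2 \<Longrightarrow>
    L2_inner (\<lambda>x. f x + g x) k = L2_inner f k + L2_inner g k"
  unfolding L2_inner_def by (simp add: distrib_right L2_inner_integrable)

lemma L2_inner_diff_left: "f \<in> L2 \<Longrightarrow> g \<in> L2 \<Longrightarrow> k \<in> L2 \<Longrightarrow>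
    L2_inner (\<lambda>x. f x - g x) k = L2_inner f k - L2_inner g k"
  unfolding L2_inner_def by (simp add: left_diff_distrib L2_inner_integrable)

lemma L2_inner_scale_left: "L2_inner (\<lambda>x. c * f x) k = c * L2_inner f k"
  unfolding L2_inner_def by (simp add: mult.assoc)

lemma L2_inner_cnj: "cnj (L2_inner f g) = L2_inner g f"
  unfolding L2_inner_def by (subst Bochner_Integration.integral_cnj[symmetric]) (simp add: mult.commute)

lemma L2_inner_sum_left: "finite A \<Longrightarrow> (\<And>i. i \<in> A \<Longrightarrow> f i \<in> L2) \<Longrightarrow> k \<in> L2 \<Longrightarrow>
    L2_inner (\<lambda>x. \<Sum>i\<in>A. f i x) k = (\<Sum>i\<in>A. L2_inner (f i) k)"
  unfolding L2_inner_def by (simp add: sum_distrib_right L2_inner_integrable)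

lemma L2_inner_cong_AE:
  assumes "f \<in> L2" "f' \<in> L2" "g \<in> L2" "AE x in I01. f x = f' x"
  shows "L2_inner f g = L2_inner f' g"
  unfolding L2_inner_def
proof (rule integral_cong_AE)
  show "(\<lambda>x. f x * cnj (g x)) \<in> borel_measurable I01" "(\<lambda>x. f' x * cnj (g x)) \<in> borel_measurable I01"
    using assms(1-3)[THEN L2_measurable] by measurable
qed (use assms(4) in auto)

lemma L2_inner_self: "L2_inner f f = of_real (\<integral>x. (cmod (f x))\<^sup>2 \<partial>I01)"
  unfolding L2_inner_def complex_norm_square[symmetric] by (rule integral_complex_of_real)

lemma L2_norm_square: "(L2_norm f)\<^sup>2 = (\<integral>x. (cmod (f x))\<^sup>2 \<partial>I01)"
  unfolding L2_norm_def L2_inner_self by (simp add: integral_nonneg)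

definition fexp :: "int \<Rightarrow> real \<Rightarrow> complex" where
  "fexp n x = cis (2 * pi * of_int n * x)"

definition fcoeff :: "(real \<Rightarrow> complex) \<Rightarrow> int \<Rightarrow> complex" where
  "fcoeff f n = L2_inner f (fexp n)"

lemma continuous_on_fexp [continuous_intros]: "continuous_on S (fexp n)"
  unfolding fexp_def by (intro continuous_intros)

lemma fexp_L2: "fexp n \<in> L2"
  by (intro L2_continuous continuous_intros)

lemma fexp_add: "fexp m x * fexp n x = fexp (m + n) x"
  by (simp add: fexp_def cis_mult algebra_simps)

lemma cnj_fexp: "cnj (fexp n x) = fexp (- n) x"
  by (simp add: fexp_def cis_cnj)

lemma fexp_0 [simp]: "fexp 0 x = 1" "fexp n 0 = 1"
  by (simp_all add: fexp_def)

lemma fexp_1 [simp]: "fexp n 1 = 1"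
  by (simp add: fexp_def cis_multiple_2pi)

lemma norm_fexp [simp]: "cmod (fexp n x) = 1"
  by (simp add: fexp_def)

lemma fexp_has_vector_derivative:
  "(fexp n has_vector_derivative (2 * pi * of_int n * \<i> * fexp n x)) (at x within S)"
proof -
  have "((\<lambda>z. exp (2 * pi * of_int n * \<i> * z)) has_field_derivative
        (2 * pi * of_int n * \<i> * exp (2 * pi * of_int n * \<i> * of_real x))) (at (of_real x) within of_real ` S)"
    by (auto intro!: derivative_eq_intros)
  then have "((\<lambda>z. exp (2 * pi * of_int n * \<i> * z)) \<circ> of_real has_vector_derivative
        1 * (2 * pi * of_int n * \<i> * exp (2 * pi * of_int n * \<i> * of_real x))) (at x within S)"
    by (intro field_vector_diff_chain_within) (auto intro!: derivative_eq_intros)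
  moreover have "(\<lambda>z. exp (2 * pi * of_int n * \<i> * z)) \<circ> of_real = fexp n"
    by (auto simp: fexp_def cis_conv_exp algebra_simps)
  ultimately show ?thesis by (simp add: fexp_def cis_conv_exp algebra_simps)
qed

lemma integral_fexp: "(\<integral>x. fexp n x \<partial>I01) = (if n = 0 then 1 else 0)"
proof (cases "n = 0")
  case False
  have "(\<integral>x. fexp n x \<partial>I01) = fexp n 1 / (2 * pi * of_int n * \<i>) - fexp n 0 / (2 * pi * of_int n * \<i>)"
  proof (rule integral_I01_FTC)
    fix x :: real
    show "((\<lambda>x. fexp n x / (2 * pi * of_int n * \<i>)) has_vector_derivative fexp n x) (at x within {0..1})"
      using has_vector_derivative_divide[OF fexp_has_vector_derivative, of n "2 * pi * of_int n * \<i>" x "{0..1}"] False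
      by simp
  qed (intro continuous_intros)
  then show ?thesis using False by simp
qed simp

lemma fcoeff_fexp: "fcoeff (fexp m) n = (if m = n then 1 else 0)"
  by (auto simp: fcoeff_def L2_inner_def cnj_fexp fexp_add integral_fexp)

section \<open>Density of trigonometric polynomials\<close>

text \<open>Generated by monomials and sums, so that continuity and closure under products are plain
  inductions; \<open>trig_poly_sum\<close> restores the finite sum with one coefficient per
  frequency.\<close>

inductive_set trig_poly :: "(real \<Rightarrow> complex) set" where
  monom: "(\<lambda>x. c * fexp n x) \<in> trig_poly"
| add: "p \<in> trig_poly \<Longrightarrow> q \<in> trig_poly \<Longrightarrow> (\<lambda>x. p x + q x) \<in> trig_poly"

lemma trig_poly_const: "(\<lambda>x. c) \<in> trig_poly"
  using trig_poly.monom[of c 0] by simp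

lemma trig_poly_monom_mult: "p \<in> trig_poly \<Longrightarrow> (\<lambda>x. c * fexp n x * p x) \<in> trig_poly"
proof (induction rule: trig_poly.induct)
  case (monom d m)
  have "(\<lambda>x. c * fexp n x * (d * fexp m x)) = (\<lambda>x. (c * d) * fexp (n + m) x)"
    by (simp flip: fexp_add add: mult_ac)
  then show ?case by (simp add: trig_poly.monom)
next
  case (add p q)
  then show ?case using trig_poly.add by (fastforce simp: distrib_left)
qed

lemma trig_poly_mult: "p \<in> trig_poly \<Longrightarrow> q \<in> trig_poly \<Longrightarrow> (\<lambda>x. p x * q x) \<in> trig_poly"
proof (induction rule: trig_poly.induct)
  case (add p q)
  then show ?case using trig_poly.add by (fastforce simp: distrib_right)
qed (rule trig_poly_monom_mult)

lemma trig_poly_continuous: "p \<in> trig_poly \<Longrightarrow> continuous_on S p"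
  by (induction rule: trig_poly.induct) (auto intro!: continuous_intros)

lemma trig_poly_sum:
  assumes "p \<in> trig_poly"
  obtains A c where "finite A" "p = (\<lambda>x. \<Sum>n\<in>A. c n * fexp n x)"
proof -
  have "\<exists>A c. finite A \<and> p = (\<lambda>x. \<Sum>n\<in>A. c n * fexp n x)"
    using assms
  proof (induction rule: trig_poly.induct)
    case (monom c n)
    show ?case by (intro exI[of _ "{n}"] exI[of _ "\<lambda>_. c"]) auto
  next
    case (add p q)
    then obtain A c B d where A: "finite A" "p = (\<lambda>x. \<Sum>n\<in>A. c n * fexp n x)"
      and B: "finite B" "q = (\<lambda>x. \<Sum>n\<in>B. d n * fexp n x)" by blast
    have "p x = (\<Sum>n\<in>A \<union> B. (if n \<in> A then c n else 0) * fexp n x)" for x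
      using A(1) B(1) unfolding A(2) by (intro sum.mono_neutral_cong_left) auto
    moreover have "q x = (\<Sum>n\<in>A \<union> B. (if n \<in> B then d n else 0) * fexp n x)" for x
      using A(1) B(1) unfolding B(2) by (intro sum.mono_neutral_cong_left) auto
    ultimately have "(\<lambda>x. p x + q x) = (\<lambda>x. \<Sum>n\<in>A \<union> B.
        ((if n \<in> A then c n else 0) + (if n \<in> B then d n else 0)) * fexp n x)"
      by (simp only: distrib_right sum.distrib)
    with A(1) B(1) show ?case
      by (intro exI[of _ "A \<union> B"] exI[of _ "\<lambda>n. (if n \<in> A then c n else 0) + (if n \<in> B then d n else 0)"] conjI)
        simp_all
  qed
  then show ?thesis using that by blast
qed

lemma trig_poly_Re_Im_cis:
  "(\<lambda>x. complex_of_real (Re (fexp 1 x))) \<in> trig_poly" "(\<lambda>x. complex_of_real (Im (fexp 1 x))) \<in> trig_poly"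
proof -
  have "complex_of_real (Re (fexp 1 x)) = (1/2) * fexp 1 x + (1/2) * fexp (-1) x" for x
    unfolding cnj_fexp[symmetric] using complex_add_cnj[of "fexp 1 x"] by (simp add: field_simps)
  then show "(\<lambda>x. complex_of_real (Re (fexp 1 x))) \<in> trig_poly"
    by (simp only:) (intro trig_poly.intros)
  have "complex_of_real (Im (fexp 1 x)) = (1 / (2 * \<i>)) * fexp 1 x + (- 1 / (2 * \<i>)) * fexp (-1) x" for x
    unfolding cnj_fexp[symmetric] using complex_diff_cnj[of "fexp 1 x"] by (simp add: field_simps)
  then show "(\<lambda>x. complex_of_real (Im (fexp 1 x))) \<in> trig_poly"
    by (simp only:) (intro trig_poly.intros)
qed

text \<open>Stone-Weierstrass in its real form. The algebra consists of the continuous real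
  functions on the circle whose pullback along \<open>fexp 1\<close> is a trigonometric polynomial;
  \<open>Re\<close> and \<open>Im\<close> belong to it and separate points.\<close>

lemma trig_poly_uniform_circle:
  fixes G :: "complex \<Rightarrow> real"
  assumes "continuous_on (sphere 0 1) G" "e > 0"
  obtains p where "p \<in> trig_poly" "\<And>x. cmod (of_real (G (fexp 1 x)) - p x) < e"
proof -
  define P where "P = (\<lambda>f :: complex \<Rightarrow> real. continuous_on (sphere 0 1) f \<and> (\<lambda>x. complex_of_real (f (fexp 1 x))) \<in> trig_poly)"
  have "\<exists>g. P g \<and> (\<forall>z\<in>sphere 0 1. \<bar>G z - g z\<bar> < e)"
  proof (rule Stone_Weierstrass_HOL)
    show "P (\<lambda>z. c)" for c unfolding P_def by (auto intro: trig_poly_const)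
    show "P (\<lambda>z. f z + g z)" if "P f \<and> P g" for f g
      using that unfolding P_def by (auto intro!: continuous_intros trig_poly.add)
    show "P (\<lambda>z. f z * g z)" if "P f \<and> P g" for f g
      using that unfolding P_def by (auto intro!: continuous_intros trig_poly_mult)
    have "P Re" "P Im" unfolding P_def
      using trig_poly_Re_Im_cis by (auto intro!: continuous_intros)
    then show "\<exists>f. P f \<and> f z \<noteq> f w" if "z \<in> sphere 0 1 \<and> w \<in> sphere 0 1 \<and> z \<noteq> w" for z w :: complex
      using that complex_eqI by blast
  qed (use assms in \<open>auto simp: P_def\<close>)
  then obtain g where g: "P g" "\<And>z. z \<in> sphere 0 1 \<Longrightarrow> \<bar>G z - g z\<bar> < e" by blast
  show ?thesis
  proof (rule that)
    show "(\<lambda>x. complex_of_real (g (fexp 1 x))) \<in> trig_poly" using g(1) by (simp add: P_def)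
    show "cmod (of_real (G (fexp 1 x)) - complex_of_real (g (fexp 1 x))) < e" for x
      using g(2)[of "fexp 1 x"] by (simp flip: of_real_diff)
  qed
qed

text \<open>Equal end values let \<open>g\<close> descend to the circle through the normalised
  argument; real and imaginary parts are then approximated separately.\<close>

lemma trig_poly_uniform:
  fixes g :: "real \<Rightarrow> complex"
  assumes "continuous_on {0..1} g" "g 0 = g 1" "e > 0"
  obtains p where "p \<in> trig_poly" "\<And>x. x \<in> {0..1} \<Longrightarrow> cmod (g x - p x) < e"
proof -
  define G where "G = g \<circ> (\<lambda>z. Arg2pi z / (2 * pi))"
  \<comment> \<open>Only the constant homotopy is used: continuity of the induced circle map is part
    of the statement that homotopic loops induce homotopic circle maps.\<close>
  have "homotopic_loops UNIV g g"
    using assms(1,2) by (simp add: homotopic_loops_refl path_def pathstart_def pathfinish_def)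
  then have G: "continuous_on (sphere 0 1) G"
    unfolding G_def by (metis homotopic_loops_imp_homotopic_circlemaps homotopic_with_imp_continuous)
  have Gg: "G (fexp 1 x) = g x" if "x \<in> {0..1}" for x
  proof (cases "x = 1")
    case True
    then show ?thesis using assms(2) Arg2pi_of_real[of 1] by (simp add: G_def)
  next
    case False
    have "Arg2pi (fexp 1 x) = 2 * pi * x"
      by (rule Arg2pi_unique[of 1]) (use that False in \<open>auto simp: fexp_def cis_conv_exp\<close>)
    then show ?thesis by (simp add: G_def)
  qed
  obtain p where p: "p \<in> trig_poly" "\<And>x. cmod (of_real (Re (G (fexp 1 x))) - p x) < e / 2"
    using trig_poly_uniform_circle[of "\<lambda>z. Re (G z)" "e/2"] G assms(3) by (auto intro!: continuous_intros)
  obtain q where q: "q \<in> trig_poly" "\<And>x. cmod (of_real (Im (G (fexp 1 x))) - q x) < e / 2"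
    using trig_poly_uniform_circle[of "\<lambda>z. Im (G z)" "e/2"] G assms(3) by (auto intro!: continuous_intros)
  show ?thesis
  proof (rule that)
    show "(\<lambda>x. p x + \<i> * q x) \<in> trig_poly"
      by (intro trig_poly.add p trig_poly_mult trig_poly_const q)
    show "cmod (g x - (p x + \<i> * q x)) < e" if x: "x \<in> {0..1}" for x
    proof -
      have "g x - (p x + \<i> * q x) = (of_real (Re (G (fexp 1 x))) - p x) + \<i> * (of_real (Im (G (fexp 1 x))) - q x)"
        using complex_eq[of "g x"] Gg[OF x] by (simp add: algebra_simps)
      also have "cmod \<dots> \<le> cmod (of_real (Re (G (fexp 1 x))) - p x) + cmod (\<i> * (of_real (Im (G (fexp 1 x))) - q x))"
        by (rule norm_triangle_ineq)
      also have "\<dots> < e" using p(2)[of x] q(2)[of x] by (simp add: norm_mult)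
      finally show ?thesis .
    qed
  qed
qed

text \<open>\<open>f\<close> is replaced by 0 where its modulus exceeds \<open>k\<close>, and
  dominated convergence with majorant \<open>|f|^2\<close> makes the error small. The bound
  \<open>real k + 1\<close> stays positive for \<open>k = 0\<close>.\<close>

lemma L2_approx_bounded:
  assumes f: "f \<in> L2" and "e > 0"
  obtains g K where "g \<in> borel_measurable I01" "K > 0" "\<And>x. cmod (g x) \<le> K"
    "(\<integral>x. (cmod (f x - g x))\<^sup>2 \<partial>I01) < e"
proof -
  define g where "g = (\<lambda>(k::nat) x. if cmod (f x) \<le> real k then f x else 0)"
  have meas: "g k \<in> borel_measurable I01" for k
    using L2_measurable[OF f] unfolding g_def by measurable
  have "(\<lambda>k. \<integral>x. (cmod (f x - g k x))\<^sup>2 \<partial>I01) \<longlonglongrightarrow> (\<integral>x. 0 \<partial>I01)"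
  proof (rule integral_dominated_convergence)
    show "integrable I01 (\<lambda>x. (cmod (f x))\<^sup>2)" using f by (rule L2_norm_integrable)
    show "(\<lambda>x. (cmod (f x - g k x))\<^sup>2) \<in> borel_measurable I01" for k
      using L2_measurable[OF f] meas by measurable
    show "AE x in I01. (\<lambda>k. (cmod (f x - g k x))\<^sup>2) \<longlonglongrightarrow> 0"
    proof (intro AE_I2 tendsto_eventually)
      fix x
      obtain N where "cmod (f x) \<le> real N" using real_arch_simple by blast
      then show "\<forall>\<^sub>F k in sequentially. (cmod (f x - g k x))\<^sup>2 = 0"
        unfolding g_def by (intro eventually_sequentiallyI[of N]) auto
    qed
    show "AE x in I01. norm ((cmod (f x - g k x))\<^sup>2) \<le> (cmod (f x))\<^sup>2" for k
      by (auto simp: g_def)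
  qed simp
  then have "\<forall>\<^sub>F k in sequentially. (\<integral>x. (cmod (f x - g k x))\<^sup>2 \<partial>I01) < e"
    using \<open>e > 0\<close> by (intro order_tendstoD(2)) simp
  then obtain k where k: "(\<integral>x. (cmod (f x - g k x))\<^sup>2 \<partial>I01) < e"
    unfolding eventually_sequentially by blast
  show ?thesis
    by (rule that[OF meas _ _ k, of "real k + 1"]) (auto simp: g_def)
qed

text \<open>A bounded measurable function is an a.e. limit of continuous functions; composing these with a
  retraction to a disc and multiplying by cut-offs makes them uniformly bounded and periodic.\<close>

lemma L2_approx_continuous:
  assumes f: "f \<in> borel_measurable I01" and K: "K > 0" "\<And>x. cmod (f x) \<le> K" and "e > 0"
  obtains g where "continuous_on {0..1} g" "g 0 = g 1" "(\<integral>x. (cmod (f x - g x))\<^sup>2 \<partial>I01) < e"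
proof -
  have "f measurable_on {0<..<1}"
    using f by (simp add: measurable_on_iff_borel_measurable)
  then obtain N h where N: "negligible N" and h: "\<And>n. continuous_on UNIV (h n)"
    and lim: "\<And>x. x \<notin> N \<Longrightarrow> (\<lambda>n. h n x) \<longlonglongrightarrow> (if x \<in> {0<..<1} then f x else 0)"
    unfolding measurable_on_def by blast
  define c where "c = (\<lambda>z. of_real (K / max K (cmod z)) * z)"
  define \<phi> where "\<phi> = (\<lambda>(n::nat) x::real. max 0 (min 1 (real n * (x * (1 - x)))))"
  define g where "g = (\<lambda>n x. of_real (\<phi> n x) * c (h n x))"
  have c: "continuous_on UNIV c"
    unfolding c_def using K(1) by (intro continuous_intros) auto
  have norm_c: "cmod (c z) \<le> K" for z
    unfolding c_def using K(1) by (auto simp: norm_mult norm_divide field_simps max_def)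
  have c_id: "c z = z" if "cmod z \<le> K" for z
    unfolding c_def using K(1) that by (simp add: max_absorb1)
  have g_cont: "continuous_on S (g n)" for n S
    unfolding g_def \<phi>_def
    by (intro continuous_intros continuous_on_compose2[OF c] continuous_on_subset[OF h]) auto
  have g_le: "cmod (g n x) \<le> K" for n x
  proof -
    have "\<bar>\<phi> n x\<bar> \<le> 1" by (auto simp: \<phi>_def)
    then have "\<bar>\<phi> n x\<bar> * cmod (c (h n x)) \<le> 1 * K"
      using norm_c by (intro mult_mono) auto
    then show ?thesis by (simp add: g_def norm_mult)
  qed
  have g_meas: "g n \<in> borel_measurable I01" for n
    by (rule measurable_I01_continuous[OF g_cont])
  have "(\<lambda>n. \<integral>x. (cmod (f x - g n x))\<^sup>2 \<partial>I01) \<longlonglongrightarrow> (\<integral>x. 0 \<partial>I01)"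
  proof (rule integral_dominated_convergence)
    show "integrable I01 (\<lambda>x. (2 * K)\<^sup>2)" by simp
    show "(\<lambda>x. (cmod (f x - g n x))\<^sup>2) \<in> borel_measurable I01" for n
      using f g_meas by measurable
    have "AE x in lebesgue. x \<notin> N"
      using N by (metis (no_types, lifting) AE_I' mem_Collect_eq negligible_iff_null_sets subsetI)
    then have "AE x in I01. x \<notin> N"
      by (auto simp: AE_restrict_space_iff elim: eventually_mono)
    moreover have "(\<lambda>n. (cmod (f x - g n x))\<^sup>2) \<longlonglongrightarrow> 0" if x: "x \<notin> N" "x \<in> {0<..<1}" for x
    proof -
      have "(\<lambda>n. h n x) \<longlonglongrightarrow> f x" using lim[OF x(1)] x(2) by simp
      then have "(\<lambda>n. c (h n x)) \<longlonglongrightarrow> c (f x)"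
        using c by (auto intro: continuous_on_tendsto_compose)
      moreover have "(\<lambda>n. \<phi> n x) \<longlonglongrightarrow> 1"
      proof (rule tendsto_eventually)
        obtain M where M: "1 \<le> real M * (x * (1 - x))"
          using reals_Archimedean3[of "x * (1 - x)"] x(2)
          by (metis greaterThanLessThan_iff less_imp_le mult_pos_pos diff_gt_0_iff_gt)
        have "1 \<le> real n * (x * (1 - x))" if "M \<le> n" for n
          by (rule order_trans[OF M]) (intro mult_right_mono; use that x(2) in simp)
        then show "\<forall>\<^sub>F n in sequentially. \<phi> n x = 1"
          unfolding \<phi>_def by (intro eventually_sequentiallyI[of M]) auto
      qed
      ultimately have "(\<lambda>n. g n x) \<longlonglongrightarrow> of_real 1 * c (f x)"
        unfolding g_def by (intro tendsto_intros)
      then have "(\<lambda>n. g n x) \<longlonglongrightarrow> f x" using c_id K(2) by simp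
      then have "(\<lambda>n. (cmod (f x - g n x))\<^sup>2) \<longlonglongrightarrow> (cmod (f x - f x))\<^sup>2"
        by (intro tendsto_intros)
      then show ?thesis by simp
    qed
    ultimately show "AE x in I01. (\<lambda>n. (cmod (f x - g n x))\<^sup>2) \<longlonglongrightarrow> 0"
      by (auto simp: AE_restrict_space_iff)
    have "cmod (f x - g n x) \<le> 2 * K" for n x
      using norm_triangle_ineq4[of "f x" "g n x"] K(2)[of x] g_le[of n x] by linarith
    then show "AE x in I01. norm ((cmod (f x - g n x))\<^sup>2) \<le> (2 * K)\<^sup>2" for n
      by (intro AE_I2) (simp only: real_norm_def abs_power2 power_mono[OF _ norm_ge_zero])
  qed simp
  then have "\<forall>\<^sub>F n in sequentially. (\<integral>x. (cmod (f x - g n x))\<^sup>2 \<partial>I01) < e"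
    using \<open>e > 0\<close> by (intro order_tendstoD(2)) simp
  then obtain n where n: "(\<integral>x. (cmod (f x - g n x))\<^sup>2 \<partial>I01) < e"
    unfolding eventually_sequentially by blast
  show ?thesis
    by (rule that[OF g_cont _ n]) (simp add: g_def \<phi>_def)
qed

lemma integral_norm_square_add_le:
  assumes "f \<in> L2" "g \<in> L2"
  shows "(\<integral>x. (cmod (f x + g x))\<^sup>2 \<partial>I01) \<le> 2 * (\<integral>x. (cmod (f x))\<^sup>2 \<partial>I01) + 2 * (\<integral>x. (cmod (g x))\<^sup>2 \<partial>I01)"
proof -
  have "(\<integral>x. (cmod (f x + g x))\<^sup>2 \<partial>I01) \<le> (\<integral>x. 2 * (cmod (f x))\<^sup>2 + 2 * (cmod (g x))\<^sup>2 \<partial>I01)"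
    using assms by (intro integral_mono norm_sum_square_le L2_norm_integrable[OF L2_add])
      (auto simp: L2_norm_integrable)
  also have "\<dots> = 2 * (\<integral>x. (cmod (f x))\<^sup>2 \<partial>I01) + 2 * (\<integral>x. (cmod (g x))\<^sup>2 \<partial>I01)"
    using assms by (simp add: L2_norm_integrable)
  finally show ?thesis .
qed

lemma trig_poly_L2: "p \<in> trig_poly \<Longrightarrow> p \<in> L2"
  by (intro L2_continuous trig_poly_continuous)

theorem trig_poly_dense:
  assumes f: "f \<in> L2" and "e > 0"
  obtains p where "p \<in> trig_poly" "(\<integral>x. (cmod (f x - p x))\<^sup>2 \<partial>I01) < e"
proof -
  \<comment> \<open>Twelfths suffice because \<open>|a + b|^2 \<le> 2 |a|^2 + 2 |b|^2\<close> is
    applied twice: it costs \<open>4 e / 12\<close> for \<open>g - p\<close>, then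
    \<open>2 e / 12 + 8 e / 12 < e\<close> for \<open>f - p\<close>.\<close>
  obtain g K where g: "g \<in> borel_measurable I01" "K > 0" "\<And>x. cmod (g x) \<le> K"
    "(\<integral>x. (cmod (f x - g x))\<^sup>2 \<partial>I01) < e / 12"
    using L2_approx_bounded[OF f, of "e/12"] \<open>e > 0\<close> by auto
  obtain k where k: "continuous_on {0..1} k" "k 0 = k 1" "(\<integral>x. (cmod (g x - k x))\<^sup>2 \<partial>I01) < e / 12"
    using L2_approx_continuous[OF g(1-3), of "e/12"] \<open>e > 0\<close> by auto
  obtain p where p: "p \<in> trig_poly" "\<And>x. x \<in> {0..1} \<Longrightarrow> cmod (k x - p x) < sqrt (e / 12)"
    using trig_poly_uniform[OF k(1,2), of "sqrt (e/12)"] \<open>e > 0\<close> by auto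
  have L2: "g \<in> L2" "k \<in> L2" "p \<in> L2"
    using L2_bounded[OF g(1), of K] g(3) L2_continuous[OF k(1)] trig_poly_L2[OF p(1)] by auto
  have "(\<integral>x. (cmod (k x - p x))\<^sup>2 \<partial>I01) \<le> (\<integral>x. e / 12 \<partial>I01)"
  proof (rule integral_mono)
    show "(cmod (k x - p x))\<^sup>2 \<le> e / 12" if "x \<in> space I01" for x
      using p(2)[of x] that \<open>e > 0\<close> power_mono[of "cmod (k x - p x)" "sqrt (e/12)" 2] by simp
  qed (use L2 in \<open>auto intro: L2_norm_integrable L2_diff\<close>)
  then have kp: "(\<integral>x. (cmod (k x - p x))\<^sup>2 \<partial>I01) \<le> e / 12" by simp
  have "(\<integral>x. (cmod (g x - p x))\<^sup>2 \<partial>I01) \<le> 2 * (e / 12) + 2 * (e / 12)"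
    using integral_norm_square_add_le[OF L2_diff[OF L2(1,2)] L2_diff[OF L2(2,3)]] k(3) kp by simp
  then have "(\<integral>x. (cmod (f x - p x))\<^sup>2 \<partial>I01) < e"
    using integral_norm_square_add_le[OF L2_diff[OF f L2(1)] L2_diff[OF L2(1,3)]] g(4) \<open>e > 0\<close> by simp
  then show ?thesis using that p(1) by blast
qed

section \<open>Parseval identity and primitives\<close>

lemma fcoeff_add: "f \<in> L2 \<Longrightarrow> g \<in> L2 \<Longrightarrow> fcoeff (\<lambda>x. f x + g x) n = fcoeff f n + fcoeff g n"
  by (simp add: fcoeff_def L2_inner_add_left fexp_L2)

lemma fcoeff_diff: "f \<in> L2 \<Longrightarrow> g \<in> L2 \<Longrightarrow> fcoeff (\<lambda>x. f x - g x) n = fcoeff f n - fcoeff g n"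
  by (simp add: fcoeff_def L2_inner_diff_left fexp_L2)

lemma fcoeff_scale: "fcoeff (\<lambda>x. c * f x) n = c * fcoeff f n"
  by (simp add: fcoeff_def L2_inner_scale_left)

lemma fcoeff_cong_AE:
  "f \<in> L2 \<Longrightarrow> g \<in> L2 \<Longrightarrow> AE x in I01. f x = g x \<Longrightarrow> fcoeff f n = fcoeff g n"
  unfolding fcoeff_def by (rule L2_inner_cong_AE) (auto simp: fexp_L2)

lemma L2_inner_diff_right: "f \<in> L2 \<Longrightarrow> g \<in> L2 \<Longrightarrow> k \<in> L2 \<Longrightarrow>
    L2_inner k (\<lambda>x. f x - g x) = L2_inner k f - L2_inner k g"
  using L2_inner_diff_left[of f g k] by (metis L2_inner_cnj complex_cnj_diff)

text \<open>Completing the square. The coefficients \<open>c\<close> are arbitrary: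
  \<open>c = fcoeff f\<close> gives Bessel's inequality, and dropping the last sum bounds the
  distance to any trigonometric polynomial from below.\<close>

lemma fourier_distance:
  assumes f: "f \<in> L2" and A: "finite A"
  shows "(\<integral>x. (cmod (f x - (\<Sum>n\<in>A. c n * fexp n x)))\<^sup>2 \<partial>I01) =
    (\<integral>x. (cmod (f x))\<^sup>2 \<partial>I01) - (\<Sum>n\<in>A. (cmod (fcoeff f n))\<^sup>2) + (\<Sum>n\<in>A. (cmod (fcoeff f n - c n))\<^sup>2)"
proof -
  define p where "p = (\<lambda>x. \<Sum>n\<in>A. c n * fexp n x)"
  have p: "p \<in> L2"
    unfolding p_def by (intro L2_sum A L2_scale fexp_L2)
  have p_left: "L2_inner p k = (\<Sum>n\<in>A. c n * cnj (fcoeff k n))" if "k \<in> L2" for k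
  proof -
    have "L2_inner p k = (\<Sum>n\<in>A. L2_inner (\<lambda>x. c n * fexp n x) k)"
      unfolding p_def by (rule L2_inner_sum_left) (intro A that L2_scale fexp_L2)+
    then show ?thesis by (simp add: L2_inner_scale_left fcoeff_def L2_inner_cnj)
  qed
  have p_coeff: "fcoeff p n = c n" if "n \<in> A" for n
  proof -
    have "fcoeff p n = (\<Sum>m\<in>A. c m * cnj (fcoeff (fexp n) m))"
      unfolding fcoeff_def[of p] by (rule p_left[OF fexp_L2])
    also have "\<dots> = (\<Sum>m\<in>A. if m = n then c n else 0)"
      by (intro sum.cong) (auto simp: fcoeff_fexp)
    also have "\<dots> = c n" using that A by simp
    finally show ?thesis .
  qed
  have "L2_inner (\<lambda>x. f x - p x) (\<lambda>x. f x - p x) =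
      L2_inner f f - L2_inner f p - L2_inner p f + L2_inner p p"
    using f p by (simp add: L2_inner_diff_left L2_inner_diff_right L2_diff)
  also have "L2_inner f p = (\<Sum>n\<in>A. cnj (c n) * fcoeff f n)"
    using arg_cong[OF p_left[OF f], of cnj] by (simp add: L2_inner_cnj)
  also have "L2_inner p f = (\<Sum>n\<in>A. c n * cnj (fcoeff f n))"
    by (rule p_left[OF f])
  also have "L2_inner p p = (\<Sum>n\<in>A. c n * cnj (c n))"
    unfolding p_left[OF p] by (intro sum.cong) (simp_all add: p_coeff)
  also have "L2_inner f f - (\<Sum>n\<in>A. cnj (c n) * fcoeff f n) - (\<Sum>n\<in>A. c n * cnj (fcoeff f n)) + (\<Sum>n\<in>A. c n * cnj (c n))
     = L2_inner f f + (\<Sum>n\<in>A. c n * cnj (c n) - cnj (c n) * fcoeff f n - c n * cnj (fcoeff f n))"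
    by (simp add: sum_subtractf)
  also have "(\<Sum>n\<in>A. c n * cnj (c n) - cnj (c n) * fcoeff f n - c n * cnj (fcoeff f n)) =
     (\<Sum>n\<in>A. of_real ((cmod (fcoeff f n - c n))\<^sup>2 - (cmod (fcoeff f n))\<^sup>2))"
    by (intro sum.cong refl) (simp only: of_real_diff complex_norm_square complex_cnj_diff, simp add: algebra_simps)
  finally have "of_real (\<integral>x. (cmod (f x - p x))\<^sup>2 \<partial>I01) =
     (of_real ((\<integral>x. (cmod (f x))\<^sup>2 \<partial>I01) + (\<Sum>n\<in>A. (cmod (fcoeff f n - c n))\<^sup>2 - (cmod (fcoeff f n))\<^sup>2)) :: complex)"
    by (simp only: L2_inner_self of_real_add of_real_sum)
  then have "(\<integral>x. (cmod (f x - p x))\<^sup>2 \<partial>I01) =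
     (\<integral>x. (cmod (f x))\<^sup>2 \<partial>I01) + (\<Sum>n\<in>A. (cmod (fcoeff f n - c n))\<^sup>2 - (cmod (fcoeff f n))\<^sup>2)"
    by (simp only: of_real_eq_iff)
  then show ?thesis by (simp add: p_def sum_subtractf)
qed

lemma bessel: "f \<in> L2 \<Longrightarrow> finite A \<Longrightarrow> (\<Sum>n\<in>A. (cmod (fcoeff f n))\<^sup>2) \<le> (\<integral>x. (cmod (f x))\<^sup>2 \<partial>I01)"
proof -
  assume fA: "f \<in> L2" "finite A"
  have "0 \<le> (\<integral>x. (cmod (f x - (\<Sum>n\<in>A. fcoeff f n * fexp n x)))\<^sup>2 \<partial>I01)"
    by (rule Bochner_Integration.integral_nonneg) simp
  then show ?thesis using fourier_distance[OF fA, of "fcoeff f"] by simp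
qed

text \<open>Bessel bounds every finite sum from above. From below, a trigonometric polynomial close
  to \<open>f\<close> shows that the sum over its frequencies misses the integral by less than
  \<open>e\<close>, and larger sets only add nonnegative terms.\<close>

theorem parseval:
  assumes f: "f \<in> L2"
  shows "((\<lambda>n. (cmod (fcoeff f n))\<^sup>2) has_sum (\<integral>x. (cmod (f x))\<^sup>2 \<partial>I01)) UNIV"
  unfolding has_sum_def
proof (rule tendstoI)
  fix e :: real assume "e > 0"
  then obtain p where p: "p \<in> trig_poly" "(\<integral>x. (cmod (f x - p x))\<^sup>2 \<partial>I01) < e"
    using trig_poly_dense[OF f] by blast
  obtain A c where A: "finite A" and pA: "p = (\<lambda>x. \<Sum>n\<in>A. c n * fexp n x)"
    using trig_poly_sum[OF p(1)] by blast
  have "(\<Sum>n\<in>A. (cmod (fcoeff f n - c n))\<^sup>2) \<ge> 0" by (intro sum_nonneg) auto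
  then have lower: "(\<integral>x. (cmod (f x))\<^sup>2 \<partial>I01) - (\<Sum>n\<in>A. (cmod (fcoeff f n))\<^sup>2) < e"
    using fourier_distance[OF f A, of c] p(2) unfolding pA by linarith
  show "\<forall>\<^sub>F X in finite_subsets_at_top UNIV.
      dist (\<Sum>n\<in>X. (cmod (fcoeff f n))\<^sup>2) (\<integral>x. (cmod (f x))\<^sup>2 \<partial>I01) < e"
    unfolding eventually_finite_subsets_at_top
  proof (intro exI[of _ A] conjI allI impI)
    fix X assume X: "finite X \<and> A \<subseteq> X \<and> X \<subseteq> UNIV"
    then have "(\<Sum>n\<in>A. (cmod (fcoeff f n))\<^sup>2) \<le> (\<Sum>n\<in>X. (cmod (fcoeff f n))\<^sup>2)"
      by (intro sum_mono2) auto
    then show "dist (\<Sum>n\<in>X. (cmod (fcoeff f n))\<^sup>2) (\<integral>x. (cmod (f x))\<^sup>2 \<partial>I01) < e"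
      using lower bessel[OF f, of X] X by (simp add: dist_real_def)
  qed (use A in auto)
qed

lemma fcoeff_unique:
  assumes "f \<in> L2" "g \<in> L2" "\<And>n. fcoeff f n = fcoeff g n"
  shows "AE x in I01. f x = g x"
proof -
  have d: "(\<lambda>x. f x - g x) \<in> L2" using assms by (intro L2_diff)
  have "((\<lambda>n. 0) has_sum (\<integral>x. (cmod (f x - g x))\<^sup>2 \<partial>I01)) (UNIV :: int set)"
    using parseval[OF d] assms by (simp add: fcoeff_diff)
  then have "(\<integral>x. (cmod (f x - g x))\<^sup>2 \<partial>I01) = 0"
    using has_sum_unique has_sum_0_simp by blast
  then have "AE x in I01. (cmod (f x - g x))\<^sup>2 = 0"
    using integral_nonneg_eq_0_iff_AE[OF L2_norm_integrable[OF d]] by simp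
  then show ?thesis by simp
qed

text \<open>Absolute summability makes the series converge uniformly, so its sum is continuous and
  can be paired with any \<open>v\<close> term by term; the pairing with \<open>fexp m\<close>
  identifies its coefficients.\<close>

lemma fourier_series:
  assumes a: "(\<lambda>n. cmod (a n)) summable_on UNIV"
  obtains s where "continuous_on UNIV s" "\<And>n. fcoeff s n = a n"
    "\<And>v. v \<in> L2 \<Longrightarrow> ((\<lambda>n. a n * cnj (fcoeff v n)) has_sum L2_inner s v) UNIV"
proof -
  define s where "s = (\<lambda>x. \<Sum>\<^sub>\<infinity>n. a n * fexp n x)"
  have ul: "uniform_limit UNIV (\<lambda>X x. \<Sum>n\<in>X. a n * fexp n x) s (finite_subsets_at_top UNIV)"
    unfolding s_def by (rule Weierstrass_m_test_general[OF _ a]) (simp add: norm_mult)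
  have cont: "continuous_on UNIV s"
    by (rule uniform_limit_theorem[OF _ ul]) (auto intro!: continuous_intros)
  have s_L2: "s \<in> L2"
    by (rule L2_continuous[OF continuous_on_subset[OF cont]]) simp
  have inner: "((\<lambda>n. a n * cnj (fcoeff v n)) has_sum L2_inner s v) UNIV" if v: "v \<in> L2" for v
    unfolding has_sum_def
  proof (rule tendstoI)
    fix e :: real assume "e > 0"
    \<comment> \<open>The extra 1 keeps \<open>C\<close> positive when \<open>v\<close> vanishes and
      makes the closing estimate \<open>e / C * (C - 1) < e\<close> strict.\<close>
    define C where "C = (\<integral>x. cmod (v x) \<partial>I01) + 1"
    have "0 \<le> (\<integral>x. cmod (v x) \<partial>I01)" by (rule Bochner_Integration.integral_nonneg) simp
    then have C: "C > 0" unfolding C_def by linarith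
    have vi: "integrable I01 (\<lambda>x. cmod (v x))" using L2_integrable[OF v] by (rule integrable_norm)
    have "\<forall>\<^sub>F X in finite_subsets_at_top UNIV. \<forall>x\<in>UNIV. dist (\<Sum>n\<in>X. a n * fexp n x) (s x) < e / C"
      using ul \<open>e > 0\<close> C by (intro uniform_limitD) auto
    moreover have "\<forall>\<^sub>F X in finite_subsets_at_top (UNIV :: int set). finite X"
      by (rule eventually_finite_subsets_at_top_weakI) auto
    ultimately show "\<forall>\<^sub>F X in finite_subsets_at_top UNIV.
        dist (\<Sum>n\<in>X. a n * cnj (fcoeff v n)) (L2_inner s v) < e"
    proof eventually_elim
      case (elim X)
      define p where "p = (\<lambda>x. \<Sum>n\<in>X. a n * fexp n x)"
      have p: "p \<in> L2" unfolding p_def by (intro L2_sum elim L2_scale fexp_L2)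
      have "L2_inner p v = (\<Sum>n\<in>X. L2_inner (\<lambda>x. a n * fexp n x) v)"
        unfolding p_def by (rule L2_inner_sum_left) (intro elim v L2_scale fexp_L2)+
      then have pv: "L2_inner p v = (\<Sum>n\<in>X. a n * cnj (fcoeff v n))"
        by (simp add: L2_inner_scale_left fcoeff_def L2_inner_cnj)
      have "cmod (L2_inner p v - L2_inner s v) = cmod (\<integral>x. (p x - s x) * cnj (v x) \<partial>I01)"
        using L2_inner_diff_left[OF p s_L2 v] by (simp add: L2_inner_def)
      also have "\<dots> \<le> (\<integral>x. e / C * cmod (v x) \<partial>I01)"
      proof (rule Bochner_Integration.integral_norm_bound_integral)
        show "integrable I01 (\<lambda>x. (p x - s x) * cnj (v x))"
          using p s_L2 v by (intro L2_inner_integrable L2_diff)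
        show "integrable I01 (\<lambda>x. e / C * cmod (v x))" using vi by simp
        show "norm ((p x - s x) * cnj (v x)) \<le> e / C * cmod (v x)" for x
        proof -
          have "cmod (p x - s x) \<le> e / C"
            using elim(1) by (simp add: dist_norm p_def less_imp_le)
          then show ?thesis unfolding norm_mult complex_mod_cnj by (intro mult_right_mono) auto
        qed
      qed
      also have "\<dots> = e / C * (C - 1)" by (simp add: C_def)
      also have "\<dots> < e" using \<open>e > 0\<close> C by (simp add: field_simps)
      finally show ?case by (simp add: pv dist_norm)
    qed
  qed
  have "fcoeff s m = a m" for m
  proof -
    have "((\<lambda>n. a n * cnj (fcoeff (fexp m) n)) has_sum a m) UNIV"
      by (rule has_sum_finite_neutralI[of "{m}"]) (auto simp: fcoeff_fexp)
    then show ?thesis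
      using inner[OF fexp_L2[of m]] has_sum_unique unfolding fcoeff_def[of s] by blast
  qed
  then show ?thesis using that[OF cont] inner by blast
qed

text \<open>The sesquilinear form of Parseval's identity, reduced to the uniformly convergent series
  with the same coefficients, with which \<open>y\<close> agrees almost everywhere.\<close>

lemma L2_inner_has_sum:
  assumes y: "y \<in> L2" and sm: "(\<lambda>n. cmod (fcoeff y n)) summable_on UNIV" and v: "v \<in> L2"
  shows "((\<lambda>n. fcoeff y n * cnj (fcoeff v n)) has_sum L2_inner y v) UNIV"
proof -
  obtain s where s: "continuous_on UNIV s" "\<And>n. fcoeff s n = fcoeff y n"
    "((\<lambda>n. fcoeff y n * cnj (fcoeff v n)) has_sum L2_inner s v) UNIV"
    using fourier_series[OF sm] v by metis
  have sL: "s \<in> L2" by (rule L2_continuous[OF continuous_on_subset[OF s(1)]]) simp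
  have "L2_inner s v = L2_inner y v"
    by (rule L2_inner_cong_AE[OF sL y v fcoeff_unique[OF sL y s(2)]])
  then show ?thesis using s(3) by simp
qed

section \<open>Indefinite integrals of square-integrable functions\<close>

lemma L2_abs_integrable: assumes "g \<in> L2" shows "g absolutely_integrable_on {0..1}"
proof -
  have "integrable lebesgue (\<lambda>x. indicator {0<..<1} x *\<^sub>R g x)"
    using L2_integrable[OF assms] by (simp add: integrable_restrict_space)
  then have "g absolutely_integrable_on {0<..<1}" by (simp add: set_integrable_def)
  then show ?thesis using absolutely_integrable_on_Icc_iff_Ioo by blast
qed

lemma lebesgue_primitive:
  assumes "g \<in> L2" "x \<in> {0..1}"
  shows "(\<integral>t. g t \<partial>lebesgue_on {0..x}) = integral {0..x} g"
proof -
  have "g absolutely_integrable_on {0..x}"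
    by (rule absolutely_integrable_on_subinterval[OF L2_abs_integrable[OF assms(1)]]) (use assms(2) in auto)
  then have "integrable (lebesgue_on {0..x}) g"
    by (intro absolutely_integrable_imp_integrable) auto
  then show ?thesis by (intro lebesgue_integral_eq_integral) auto
qed

text \<open>Passes to the gauge integral, so that the fundamental theorem and the continuity of
  indefinite integrals apply directly.\<close>

lemma sobolev_deriv_iff:
  "sobolev_deriv y g \<longleftrightarrow> g \<in> L2 \<and> (\<forall>x\<in>{0..1}. y x = y 0 + integral {0..x} g)"
  unfolding sobolev_deriv_def by (auto simp: lebesgue_primitive)

lemma L2_integrable_on: "g \<in> L2 \<Longrightarrow> x \<le> 1 \<Longrightarrow> g integrable_on {0..x}"
  by (rule integrable_on_subinterval[of g "{0..1}"])
    (auto intro: absolutely_integrable_on_def[THEN iffD1, THEN conjunct1] L2_abs_integrable)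

lemma continuous_on_primitive: "g \<in> L2 \<Longrightarrow> continuous_on {0..1} (\<lambda>x. integral {0..x} g)"
  by (intro indefinite_integral_continuous_1 L2_integrable_on) auto

text \<open>The weighted inequality of arithmetic and geometric means,
  \<open>t \<le> \<delta> / 2 + t^2 / (2 \<delta>)\<close>, integrated over an interval of length
  1.\<close>

lemma L2_integral_small:
  assumes u: "u \<in> L2" and "\<delta> > 0" "(\<integral>x. (cmod (u x))\<^sup>2 \<partial>I01) < \<delta>\<^sup>2"
  shows "(\<integral>x. cmod (u x) \<partial>I01) \<le> \<delta>"
proof -
  have "cmod (u x) \<le> \<delta> / 2 + (cmod (u x))\<^sup>2 * (1 / (2 * \<delta>))" for x
    using sum_squares_bound[of \<delta> "cmod (u x)"] \<open>\<delta> > 0\<close> by (simp add: field_simps power2_eq_square)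
  then have "(\<integral>x. cmod (u x) \<partial>I01) \<le> (\<integral>x. \<delta> / 2 + (cmod (u x))\<^sup>2 * (1 / (2 * \<delta>)) \<partial>I01)"
    using u by (intro integral_mono) (auto intro!: L2_norm_integrable integrable_norm L2_integrable)
  also have "\<dots> = \<delta> / 2 + (\<integral>x. (cmod (u x))\<^sup>2 \<partial>I01) * (1 / (2 * \<delta>))"
    using L2_norm_integrable[OF u] by simp
  also have "\<dots> \<le> \<delta> / 2 + \<delta>\<^sup>2 * (1 / (2 * \<delta>))"
    using assms by (intro add_left_mono mult_right_mono) auto
  also have "\<dots> = \<delta>" using \<open>\<delta> > 0\<close> by (simp add: power2_eq_square)
  finally show ?thesis .
qed

text \<open>Integration by parts for a primitive of an \<open>L\<^sup>2\<close> function: the defect of the identity is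
  continuous in the norm and vanishes on continuous functions.\<close>

lemma fcoeff_primitive:
  assumes g: "g \<in> L2"
  shows "2 * pi * of_int n * \<i> * fcoeff (\<lambda>x. integral {0..x} g) n = fcoeff g n - fcoeff g 0"
proof -
  define J where "J = (\<lambda>g :: real \<Rightarrow> complex. \<lambda>x. integral {0..x} g)"
  define D where "D = (\<lambda>g. fcoeff g n - fcoeff g 0 - 2 * pi * of_int n * \<i> * fcoeff (J g) n)"
  have J: "J g \<in> L2" if "g \<in> L2" for g
    unfolding J_def by (intro L2_continuous continuous_on_primitive that)
  have D_cont: "D g = 0" if "continuous_on {0..1} g" for g
  proof -
    have gL: "g \<in> L2" by (rule L2_continuous[OF that])
    have der: "((\<lambda>x. J g x * fexp (-n) x) has_vector_derivative
        (J g x * (2 * pi * of_int (-n) * \<i> * fexp (-n) x) + g x * fexp (-n) x)) (at x within {0..1})"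
      if "x \<in> {0..1}" for x
      unfolding J_def
      by (intro has_vector_derivative_mult fexp_has_vector_derivative integral_has_vector_derivative
          \<open>continuous_on _ g\<close> that)
    have "(\<integral>x. J g x * (2 * pi * of_int (-n) * \<i> * fexp (-n) x) + g x * fexp (-n) x \<partial>I01)
        = J g 1 * fexp (-n) 1 - J g 0 * fexp (-n) 0"
      by (rule integral_I01_FTC[OF _ der])
        (auto simp: J_def intro!: continuous_intros that continuous_on_primitive gL)
    also have "\<dots> = fcoeff g 0"
      using gL by (simp add: J_def fcoeff_def L2_inner_def integral_I01_eq L2_integrable)
    also have "(\<integral>x. J g x * (2 * pi * of_int (-n) * \<i> * fexp (-n) x) + g x * fexp (-n) x \<partial>I01)
        = (\<integral>x. (2 * pi * of_int (-n) * \<i>) * (J g x * cnj (fexp n x)) + g x * cnj (fexp n x) \<partial>I01)"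
      by (simp add: cnj_fexp mult_ac)
    also have "\<dots> = (2 * pi * of_int (-n) * \<i>) * fcoeff (J g) n + fcoeff g n"
      unfolding fcoeff_def L2_inner_def
      by (subst Bochner_Integration.integral_add)
        (auto intro!: L2_inner_integrable J gL fexp_L2 integrable_mult_right)
    finally show ?thesis unfolding D_def by (simp add: algebra_simps)
  qed
  \<comment> \<open>One unit for each of the two coefficients of \<open>u\<close>, and
    \<open>2 pi |n|\<close> for the coefficient of its primitive, whose modulus stays below the
    integral of \<open>|u|\<close>.\<close>
  define C where "C = 2 + 2 * pi * \<bar>of_int n\<bar>"
  have D_bound: "cmod (D u) \<le> C * (\<integral>x. cmod (u x) \<partial>I01)" if u: "u \<in> L2" for u
  proof -
    have coeff: "cmod (fcoeff w m) \<le> (\<integral>x. cmod (w x) \<partial>I01)" if "w \<in> L2" for w m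
    proof -
      have "cmod (fcoeff w m) \<le> (\<integral>x. norm (w x * cnj (fexp m x)) \<partial>I01)"
        unfolding fcoeff_def L2_inner_def by (rule integral_norm_bound)
      then show ?thesis by (simp add: norm_mult)
    qed
    have ui: "integrable I01 (\<lambda>x. cmod (u x))" by (intro integrable_norm L2_integrable u)
    have ni: "(\<lambda>x. cmod (u x)) integrable_on {0..x}" if "x \<le> 1" for x
      by (rule integrable_on_subinterval[of _ "{0..1}"])
        (use that L2_abs_integrable[OF u] in \<open>auto simp: absolutely_integrable_on_def\<close>)
    have "cmod (J u x) \<le> (\<integral>x. cmod (u x) \<partial>I01)" if "x \<in> {0..1}" for x
    proof -
      have "cmod (J u x) \<le> integral {0..x} (\<lambda>x. cmod (u x))"
        unfolding J_def using that
        by (intro Henstock_Kurzweil_Integration.integral_norm_bound_integral L2_integrable_on u ni) auto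
      also have "\<dots> \<le> integral {0..1} (\<lambda>x. cmod (u x))"
        using that by (intro integral_subset_le ni) auto
      finally show ?thesis by (simp add: integral_I01_eq[OF ui])
    qed
    then have "(\<integral>x. cmod (J u x) \<partial>I01) \<le> (\<integral>x. (\<integral>x. cmod (u x) \<partial>I01) \<partial>I01)"
      by (intro integral_mono integrable_norm L2_integrable J u) auto
    then have "cmod (fcoeff (J u) n) \<le> (\<integral>x. cmod (u x) \<partial>I01)"
      using coeff[OF J[OF u], of n] by simp
    then have "cmod (2 * pi * of_int n * \<i> * fcoeff (J u) n) \<le> 2 * pi * \<bar>of_int n\<bar> * (\<integral>x. cmod (u x) \<partial>I01)"
      by (simp add: norm_mult mult_left_mono)
    moreover have "cmod (D u) \<le> cmod (fcoeff u n) + cmod (fcoeff u 0) + cmod (2 * pi * of_int n * \<i> * fcoeff (J u) n)"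
      unfolding D_def by (meson add_mono norm_triangle_ineq4 order_refl order_trans)
    ultimately show ?thesis
      using coeff[OF u, of n] coeff[OF u, of 0] by (simp add: C_def algebra_simps)
  qed
  have small: "cmod (D g) \<le> C * \<delta>" if \<delta>: "\<delta> > 0" for \<delta>
  proof -
    obtain p where p: "p \<in> trig_poly" "(\<integral>x. (cmod (g x - p x))\<^sup>2 \<partial>I01) < \<delta>\<^sup>2"
      using trig_poly_dense[OF g zero_less_power[OF \<delta>, of 2]] by blast
    have pL: "p \<in> L2" by (rule trig_poly_L2[OF p(1)])
    have "fcoeff (J (\<lambda>x. g x - p x)) n = fcoeff (\<lambda>x. J g x - J p x) n"
      unfolding J_def fcoeff_def L2_inner_def
      by (rule Bochner_Integration.integral_cong)
        (auto simp: Henstock_Kurzweil_Integration.integral_diff L2_integrable_on g pL)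
    then have J_diff: "fcoeff (J (\<lambda>x. g x - p x)) n = fcoeff (J g) n - fcoeff (J p) n"
      by (simp add: fcoeff_diff J g pL)
    have "D (\<lambda>x. g x - p x) = D g - D p"
      unfolding D_def J_diff by (simp add: fcoeff_diff g pL right_diff_distrib)
    also have "D p = 0" by (rule D_cont[OF trig_poly_continuous[OF p(1)]])
    finally have "cmod (D g) \<le> C * (\<integral>x. cmod (g x - p x) \<partial>I01)"
      using D_bound[OF L2_diff[OF g pL]] by simp
    also have "\<dots> \<le> C * \<delta>"
      using L2_integral_small[OF L2_diff[OF g pL] \<delta> p(2)] by (intro mult_left_mono) (auto simp: C_def)
    finally show ?thesis .
  qed
  have "cmod (D g) \<le> 0"
  proof (rule field_le_epsilon)
    fix e :: real assume "e > 0"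
    moreover have "C > 0" by (simp add: C_def add_pos_nonneg)
    ultimately show "cmod (D g) \<le> 0 + e"
      using small[of "e / C"] by simp
  qed
  then show ?thesis by (simp add: D_def J_def)
qed

section \<open>Zeros and poles of the characteristic function\<close>

locale separated_points =
  fixes l :: "int \<Rightarrow> real"
  assumes separated: "m \<noteq> n \<Longrightarrow> 1 \<le> \<bar>l m - l n\<bar>"
begin

lemma point_inject: "l m = l n \<longleftrightarrow> m = n"
  using separated[of m n] by fastforce

text \<open>At most one point lies within 1/2 of \<open>\<mu>\<close>. If there is one and it
  differs from \<open>\<mu>\<close>, its distance serves as \<open>d\<close>; otherwise
  \<open>1/2\<close> does. A point equal to \<open>\<mu>\<close> is excepted, since the sums below
  are also studied at the points themselves.\<close>

lemma distance_pos:
  fixes \<mu> :: complex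
  obtains d where "d > 0" "\<And>n. of_real (l n) \<noteq> \<mu> \<Longrightarrow> d \<le> cmod (of_real (l n) - \<mu>)"
proof (cases "\<exists>m. of_real (l m) \<noteq> \<mu> \<and> cmod (of_real (l m) - \<mu>) < 1/2")
  case True
  then obtain m where m: "of_real (l m) \<noteq> \<mu>" "cmod (of_real (l m) - \<mu>) < 1/2" by blast
  have "cmod (of_real (l m) - \<mu>) \<le> cmod (of_real (l n) - \<mu>)" for n
  proof (cases "n = m")
    case False
    have "cmod (of_real (l n) - of_real (l m) :: complex) \<le> cmod (of_real (l n) - \<mu>) + cmod (of_real (l m) - \<mu>)"
      using norm_triangle_ineq4[of "of_real (l n) - \<mu>" "of_real (l m) - \<mu>"] by simp
    moreover have "cmod (of_real (l n) - of_real (l m) :: complex) = \<bar>l n - l m\<bar>"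
      by (metis norm_of_real of_real_diff)
    ultimately show ?thesis using separated[OF False] m(2) by linarith
  qed simp
  then show ?thesis using m(1) by (intro that[of "cmod (of_real (l m) - \<mu>)"]) auto
next
  case False
  then show ?thesis by (intro that[of "1/2"]) force+
qed

lemma eventually_no_point: "\<forall>\<^sub>F \<mu> in at (\<mu>0 :: complex). \<forall>n. of_real (l n) \<noteq> \<mu>"
proof -
  obtain d where d: "d > 0" "\<And>n. of_real (l n) \<noteq> \<mu>0 \<Longrightarrow> d \<le> cmod (of_real (l n) - \<mu>0)"
    using distance_pos by blast
  show ?thesis unfolding eventually_at
    using d by (intro exI[of _ d]) (force simp: dist_norm)
qed

text \<open>Division by zero yields 0, so a term with \<open>of_real (l n) = \<mu>\<close> is
  dropped. This is the right value at a point with \<open>b n = 0\<close>; at a point with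
  \<open>b n \<noteq> 0\<close> only limits over punctured neighbourhoods are meaningful.\<close>

definition cauchy_sum :: "(int \<Rightarrow> complex) \<Rightarrow> complex \<Rightarrow> complex" where
  "cauchy_sum b \<mu> = (\<Sum>\<^sub>\<infinity>n. b n / (of_real (l n) - \<mu>))"

lemma cauchy_sum_abs_summable:
  assumes "(\<lambda>n. cmod (b n)) summable_on UNIV"
  shows "(\<lambda>n. cmod (b n / (of_real (l n) - \<mu>))) summable_on UNIV"
proof -
  obtain d where d: "d > 0" "\<And>n. of_real (l n) \<noteq> \<mu> \<Longrightarrow> d \<le> cmod (of_real (l n) - \<mu>)"
    using distance_pos[of \<mu>] by blast
  have "cmod (b n / (of_real (l n) - \<mu>)) \<le> cmod (b n) * (1/d)" for n
    using d(1) d(2)[of n]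
    by (cases "of_real (l n) = \<mu>") (auto simp: norm_divide intro!: divide_left_mono mult_pos_pos)
  moreover have "(\<lambda>n. cmod (b n) * (1/d)) summable_on UNIV"
    using assms by (intro summable_on_cmult_left)
  ultimately show ?thesis
    by (intro Infinite_Sum.abs_summable_on_comparison_test')
qed

text \<open>Weierstrass M-test on a ball of radius \<open>d / 2\<close>: every point that carries a
  nonzero coefficient has distance at least \<open>d / 2\<close> from each element of the
  ball.\<close>

lemma cauchy_sum_isCont:
  assumes b: "(\<lambda>n. cmod (b n)) summable_on UNIV" and off: "\<And>n. b n \<noteq> 0 \<Longrightarrow> of_real (l n) \<noteq> \<mu>0"
  shows "isCont (cauchy_sum b) \<mu>0"
proof -
  obtain d where d: "d > 0" "\<And>n. of_real (l n) \<noteq> \<mu>0 \<Longrightarrow> d \<le> cmod (of_real (l n) - \<mu>0)"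
    using distance_pos by blast
  have far: "d / 2 \<le> cmod (of_real (l n) - \<mu>)" if "\<mu> \<in> ball \<mu>0 (d/2)" "b n \<noteq> 0" for n \<mu>
  proof -
    have "cmod (of_real (l n) - \<mu>0) \<le> cmod (of_real (l n) - \<mu>) + cmod (\<mu> - \<mu>0)"
      using norm_triangle_ineq[of "of_real (l n) - \<mu>" "\<mu> - \<mu>0"] by simp
    moreover have "cmod (\<mu> - \<mu>0) < d/2"
      using that(1) by (simp add: dist_norm norm_minus_commute)
    ultimately show ?thesis using d(2)[OF off[OF that(2)]] by linarith
  qed
  have "uniform_limit (ball \<mu>0 (d/2)) (\<lambda>X \<mu>. \<Sum>n\<in>X. b n / (of_real (l n) - \<mu>))
          (\<lambda>\<mu>. \<Sum>\<^sub>\<infinity>n. b n / (of_real (l n) - \<mu>)) (finite_subsets_at_top UNIV)"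
  proof (rule Weierstrass_m_test_general)
    fix n \<mu> assume "\<mu> \<in> ball \<mu>0 (d/2)"
    then show "norm (b n / (of_real (l n) - \<mu>)) \<le> cmod (b n) * (2 / d)"
      using far[of \<mu> n] d(1)
      by (cases "b n = 0") (auto simp: norm_divide intro!: divide_left_mono[where b="d/2", simplified] mult_pos_pos)
  next
    show "(\<lambda>n. cmod (b n) * (2/d)) summable_on UNIV"
      using b by (intro summable_on_cmult_left)
  qed
  moreover have "continuous_on (ball \<mu>0 (d/2)) (\<lambda>\<mu>. \<Sum>n\<in>X. b n / (of_real (l n) - \<mu>))" for X
  proof (intro continuous_on_sum)
    fix n
    show "continuous_on (ball \<mu>0 (d/2)) (\<lambda>\<mu>. b n / (of_real (l n) - \<mu>))"
    proof (cases "b n = 0")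
      case False
      then show ?thesis using far[of _ n] d(1)
        by (intro continuous_intros) force
    qed simp
  qed
  ultimately have "continuous_on (ball \<mu>0 (d/2)) (cauchy_sum b)"
    unfolding cauchy_sum_def[abs_def]
    by (intro uniform_limit_theorem[where F = "finite_subsets_at_top UNIV"]) auto
  then show ?thesis
    using d(1) by (simp add: continuous_on_eq_continuous_at)
qed

text \<open>Partial fractions: the difference quotient of a Cauchy sum is again a Cauchy sum, with
  coefficients divided by \<open>of_real (l n) - \<mu>0\<close>. Differentiability thus reduces to
  the continuity of such sums.\<close>

lemma cauchy_sum_diff:
  assumes b: "(\<lambda>n. cmod (b n)) summable_on UNIV"
    and off0: "\<And>n. b n \<noteq> 0 \<Longrightarrow> of_real (l n) \<noteq> \<mu>0"
    and off: "\<And>n. b n \<noteq> 0 \<Longrightarrow> of_real (l n) \<noteq> \<mu>"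
  shows "cauchy_sum b \<mu> - cauchy_sum b \<mu>0 = (\<mu> - \<mu>0) * cauchy_sum (\<lambda>n. b n / (of_real (l n) - \<mu>0)) \<mu>"
proof -
  note s = abs_summable_summable[OF cauchy_sum_abs_summable]
  have "cauchy_sum b \<mu> - cauchy_sum b \<mu>0 =
      (\<Sum>\<^sub>\<infinity>n. b n / (of_real (l n) - \<mu>) - b n / (of_real (l n) - \<mu>0))"
    using has_sum_add[OF has_sum_infsum[OF s[OF b, of \<mu>]] has_sum_uminusI[OF has_sum_infsum[OF s[OF b, of \<mu>0]]]]
    unfolding cauchy_sum_def by (simp add: infsumI)
  also have "\<dots> = (\<Sum>\<^sub>\<infinity>n. (\<mu> - \<mu>0) * (b n / (of_real (l n) - \<mu>0) / (of_real (l n) - \<mu>)))"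
  proof (rule infsum_cong)
    fix n
    show "b n / (of_real (l n) - \<mu>) - b n / (of_real (l n) - \<mu>0) =
        (\<mu> - \<mu>0) * (b n / (of_real (l n) - \<mu>0) / (of_real (l n) - \<mu>))"
    proof (cases "b n = 0")
      case False
      then have "of_real (l n) - \<mu> \<noteq> 0" "of_real (l n) - \<mu>0 \<noteq> 0"
        using off off0 by auto
      then show ?thesis by (simp add: field_simps)
    qed simp
  qed
  also have "\<dots> = (\<mu> - \<mu>0) * cauchy_sum (\<lambda>n. b n / (of_real (l n) - \<mu>0)) \<mu>"
    unfolding cauchy_sum_def
    by (rule infsum_cmult_right) (intro s cauchy_sum_abs_summable b)
  finally show ?thesis .
qed

lemma cauchy_sum_derivative:
  assumes b: "(\<lambda>n. cmod (b n)) summable_on UNIV" and off: "\<And>n. b n \<noteq> 0 \<Longrightarrow> of_real (l n) \<noteq> \<mu>0"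
  shows "(cauchy_sum b has_field_derivative cauchy_sum (\<lambda>n. b n / (of_real (l n) - \<mu>0)) \<mu>0) (at \<mu>0)"
proof -
  have "isCont (cauchy_sum (\<lambda>n. b n / (of_real (l n) - \<mu>0))) \<mu>0"
    by (intro cauchy_sum_isCont cauchy_sum_abs_summable b) (use off in auto)
  then have "(cauchy_sum (\<lambda>n. b n / (of_real (l n) - \<mu>0)) \<longlongrightarrow>
      cauchy_sum (\<lambda>n. b n / (of_real (l n) - \<mu>0)) \<mu>0) (at \<mu>0)"
    by (simp add: isCont_def)
  moreover have "\<forall>\<^sub>F \<mu> in at \<mu>0. cauchy_sum (\<lambda>n. b n / (of_real (l n) - \<mu>0)) \<mu> =
      (cauchy_sum b \<mu> - cauchy_sum b \<mu>0) / (\<mu> - \<mu>0)"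
    using eventually_no_point[of \<mu>0] eventually_neq_at_within[of \<mu>0 \<mu>0 UNIV]
    by eventually_elim (use cauchy_sum_diff[OF b off] in \<open>auto simp: field_simps\<close>)
  ultimately show ?thesis
    unfolding has_field_derivative_iff by (rule Lim_transform_eventually)
qed

lemma cauchy_sum_remove:
  assumes b: "(\<lambda>n. cmod (b n)) summable_on UNIV"
  shows "cauchy_sum b \<mu> = b m / (of_real (l m) - \<mu>) + cauchy_sum (b(m := 0)) \<mu>"
proof -
  have "(\<lambda>n. norm ((b(m := 0)) n)) summable_on UNIV"
    by (rule Infinite_Sum.abs_summable_on_comparison_test'[OF b]) auto
  then have "((\<lambda>n. (b(m := 0)) n / (of_real (l n) - \<mu>)) has_sum cauchy_sum (b(m := 0)) \<mu>) UNIV"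
    unfolding cauchy_sum_def
    by (rule has_sum_infsum[OF abs_summable_summable[OF cauchy_sum_abs_summable]])
  moreover have "((\<lambda>n. if n = m then b m / (of_real (l m) - \<mu>) else 0) has_sum b m / (of_real (l m) - \<mu>)) UNIV"
    by (rule has_sum_finite_neutralI[of "{m}"]) auto
  ultimately have "((\<lambda>n. (if n = m then b m / (of_real (l m) - \<mu>) else 0) + (b(m := 0)) n / (of_real (l n) - \<mu>)) has_sum
     (b m / (of_real (l m) - \<mu>) + cauchy_sum (b(m := 0)) \<mu>)) UNIV"
    by (rule has_sum_add[rotated])
  also have "(\<lambda>n. (if n = m then b m / (of_real (l m) - \<mu>) else 0) + (b(m := 0)) n / (of_real (l n) - \<mu>))
      = (\<lambda>n. b n / (of_real (l n) - \<mu>))" by auto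
  finally show ?thesis unfolding cauchy_sum_def by (simp add: infsumI)
qed

text \<open>Once the \<open>m\<close>-th term is split off, the rest is continuous at the point and
  is killed by the factor. The limit is minus the residue, because the denominators are
  \<open>of_real (l n) - \<mu>\<close>.\<close>

lemma cauchy_sum_pole:
  assumes b: "(\<lambda>n. cmod (b n)) summable_on UNIV"
  shows "((\<lambda>\<mu>. (of_real (l m) - \<mu>) * (1 + cauchy_sum b \<mu>)) \<longlongrightarrow> b m) (at (of_real (l m)))"
proof -
  have "(\<lambda>n. norm ((b(m := 0)) n)) summable_on UNIV"
    by (rule Infinite_Sum.abs_summable_on_comparison_test'[OF b]) auto
  then have "isCont (cauchy_sum (b(m := 0))) (of_real (l m))"
    by (rule cauchy_sum_isCont) (use point_inject in \<open>auto split: if_splits\<close>)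
  then have "((\<lambda>\<mu>. (of_real (l m) - \<mu>) * (1 + cauchy_sum (b(m := 0)) \<mu>) + b m)
      \<longlongrightarrow> (of_real (l m) - of_real (l m)) * (1 + cauchy_sum (b(m := 0)) (of_real (l m))) + b m) (at (of_real (l m)))"
    by (intro tendsto_intros) (simp add: isCont_def)
  then have "((\<lambda>\<mu>. (of_real (l m) - \<mu>) * (1 + cauchy_sum (b(m := 0)) \<mu>) + b m) \<longlongrightarrow> b m) (at (of_real (l m)))"
    by simp
  moreover have "\<forall>\<^sub>F \<mu> in at (of_real (l m)). (of_real (l m) - \<mu>) * (1 + cauchy_sum (b(m := 0)) \<mu>) + b m
      = (of_real (l m) - \<mu>) * (1 + cauchy_sum b \<mu>)"
    using eventually_no_point
  proof eventually_elim
    case (elim \<mu>)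
    then have "of_real (l m) - \<mu> \<noteq> 0" by simp
    then show ?case unfolding cauchy_sum_remove[OF b, of \<mu> m] by (simp add: field_simps)
  qed
  ultimately show ?thesis by (rule Lim_transform_eventually)
qed

section \<open>Weights of one sign and the characteristic function\<close>

definition same_sign :: "(int \<Rightarrow> real) \<Rightarrow> bool" where
  "same_sign p \<longleftrightarrow> (\<forall>n. 0 \<le> p n) \<or> (\<forall>n. p n \<le> 0)"

text \<open>\<open>w\<close> has to be nonzero only at the index of the conclusion: in the
  applications it is \<open>1 / |l n - \<mu>|^2\<close>, which is \<open>1 / 0 = 0\<close> at a
  point equal to \<open>\<mu>\<close>.\<close>

lemma same_sign_infsum_eq_0:
  assumes "same_sign p" and sm: "(\<lambda>n. p n * w n) summable_on UNIV" and "(\<Sum>\<^sub>\<infinity>n. p n * w n) = 0"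
    and w: "\<And>n. 0 \<le> w n" "w n \<noteq> 0"
  shows "p n = 0"
  using assms(1) unfolding same_sign_def
proof
  assume "\<forall>n. 0 \<le> p n"
  then have "p n * w n = 0"
    by (intro nonneg_infsum_le_0D[where f="\<lambda>n. p n * w n" and A=UNIV]) (use assms in auto)
  then show ?thesis using w(2) by simp
next
  assume neg: "\<forall>n. p n \<le> 0"
  have "(\<Sum>\<^sub>\<infinity>n. - (p n * w n)) = 0"
    using assms(3) by (simp add: infsum_uminus)
  then have "- (p n * w n) = 0"
    by (intro nonneg_infsum_le_0D[where f="\<lambda>n. - (p n * w n)" and A=UNIV])
      (use assms neg in \<open>auto simp: summable_on_uminus mult_nonpos_nonneg\<close>)
  then show ?thesis using w(2) by simp
qed

definition char_fun :: "(int \<Rightarrow> real) \<Rightarrow> complex \<Rightarrow> complex" where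
  "char_fun p \<mu> = 1 + cauchy_sum (\<lambda>n. of_real (p n)) \<mu>"

lemma abs_summable_of_real:
  assumes "p summable_on UNIV"
  shows "(\<lambda>n. norm (of_real (p n) :: complex)) summable_on UNIV"
  using summable_on_iff_abs_summable_on_real[THEN iffD1, OF assms] by simp

text \<open>Herglotz property: \<open>Im (1 / (l n - \<mu>)) = Im \<mu> / |l n - \<mu>|^2\<close>.
  With weights of one sign nothing can cancel in this sum, so off the real axis the characteristic
  function is real only if all weights vanish.\<close>

lemma Im_char_fun:
  assumes p: "p summable_on UNIV"
  shows "(\<lambda>n. p n * (1 / (cmod (of_real (l n) - \<mu>))\<^sup>2)) summable_on UNIV"
    and "Im (char_fun p \<mu>) = Im \<mu> * (\<Sum>\<^sub>\<infinity>n. p n * (1 / (cmod (of_real (l n) - \<mu>))\<^sup>2))"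
proof -
  obtain d where d: "d > 0" "\<And>n. of_real (l n) \<noteq> \<mu> \<Longrightarrow> d \<le> cmod (of_real (l n) - \<mu>)"
    using distance_pos[of \<mu>] by blast
  have "norm (p n * (1 / (cmod (of_real (l n) - \<mu>))\<^sup>2)) \<le> \<bar>p n\<bar> * (1 / d\<^sup>2)" for n
  proof (cases "of_real (l n) = \<mu>")
    case False
    have "d\<^sup>2 \<le> (cmod (of_real (l n) - \<mu>))\<^sup>2"
      using d(1) d(2)[OF False] by (simp add: power_mono)
    then have "1 / (cmod (of_real (l n) - \<mu>))\<^sup>2 \<le> 1 / d\<^sup>2"
      using d(1) by (intro divide_left_mono) (auto intro!: mult_pos_pos simp: False)
    then show ?thesis by (simp only: real_norm_def abs_mult) (intro mult_left_mono; simp)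
  qed simp
  moreover have "(\<lambda>n. \<bar>p n\<bar> * (1 / d\<^sup>2)) summable_on UNIV"
    using summable_on_iff_abs_summable_on_real[THEN iffD1, OF p] by (intro summable_on_cmult_left) simp
  ultimately have "(\<lambda>n. norm (p n * (1 / (cmod (of_real (l n) - \<mu>))\<^sup>2))) summable_on UNIV"
    by (intro Infinite_Sum.abs_summable_on_comparison_test')
  then show sm: "(\<lambda>n. p n * (1 / (cmod (of_real (l n) - \<mu>))\<^sup>2)) summable_on UNIV"
    by (rule abs_summable_summable)
  have "Im (char_fun p \<mu>) = (\<Sum>\<^sub>\<infinity>n. Im (of_real (p n) / (of_real (l n) - \<mu>)))"
    unfolding char_fun_def cauchy_sum_def
    by (simp add: infsum_Im[OF abs_summable_summable[OF cauchy_sum_abs_summable[OF abs_summable_of_real[OF p]]]])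
  also have "\<dots> = (\<Sum>\<^sub>\<infinity>n. Im \<mu> * (p n * (1 / (cmod (of_real (l n) - \<mu>))\<^sup>2)))"
    by (intro infsum_cong) (simp add: Im_divide cmod_power2)
  also have "\<dots> = Im \<mu> * (\<Sum>\<^sub>\<infinity>n. p n * (1 / (cmod (of_real (l n) - \<mu>))\<^sup>2))"
    by (rule infsum_cmult_right) (intro sm)
  finally show "Im (char_fun p \<mu>) = Im \<mu> * (\<Sum>\<^sub>\<infinity>n. p n * (1 / (cmod (of_real (l n) - \<mu>))\<^sup>2))" .
qed

lemma Im_char_fun_eq_0:
  assumes p: "p summable_on UNIV" "same_sign p" and "Im \<mu> \<noteq> 0" "Im (char_fun p \<mu>) = 0"
  shows "p n = 0"
proof (rule same_sign_infsum_eq_0[OF p(2) Im_char_fun(1)[OF p(1)]])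
  show "(\<Sum>\<^sub>\<infinity>n. p n * (1 / (cmod (of_real (l n) - \<mu>))\<^sup>2)) = 0"
    using Im_char_fun(2)[OF p(1), of \<mu>] assms(3,4) by simp
  show "1 / (cmod (of_real (l n) - \<mu>))\<^sup>2 \<noteq> 0"
    using assms(3) by (auto simp: complex_eq_iff)
qed simp

lemma char_fun_isCont:
  assumes "p summable_on UNIV" "\<And>n. p n \<noteq> 0 \<Longrightarrow> of_real (l n) \<noteq> \<mu>0"
  shows "isCont (char_fun p) \<mu>0"
  unfolding char_fun_def[abs_def]
  by (intro continuous_intros cauchy_sum_isCont abs_summable_of_real) (use assms in auto)

lemma char_fun_derivative:
  assumes "p summable_on UNIV" "\<And>n. p n \<noteq> 0 \<Longrightarrow> of_real (l n) \<noteq> \<mu>0"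
  shows "(char_fun p has_field_derivative cauchy_sum (\<lambda>n. of_real (p n) / (of_real (l n) - \<mu>0)) \<mu>0) (at \<mu>0)"
  unfolding char_fun_def[abs_def]
  by (rule derivative_eq_intros refl cauchy_sum_derivative abs_summable_of_real | use assms in force)+

text \<open>At a real point \<open>(l n - x)^2 = |l n - x|^2\<close>, so the derivative is the same
  real series that governs the imaginary part, and the sign argument applies to it as well.\<close>

lemma char_fun_derivative_real:
  assumes p: "p summable_on UNIV"
  shows "cauchy_sum (\<lambda>n. of_real (p n) / (of_real (l n) - of_real x)) (of_real x) =
     of_real (\<Sum>\<^sub>\<infinity>n. p n * (1 / (cmod (of_real (l n) - of_real x))\<^sup>2))"
proof -
  have "((\<lambda>n. of_real (p n * (1 / (cmod (of_real (l n) - of_real x))\<^sup>2)) :: complex) has_sum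
     of_real (\<Sum>\<^sub>\<infinity>n. p n * (1 / (cmod (of_real (l n) - of_real x))\<^sup>2))) UNIV"
    by (intro has_sum_of_real has_sum_infsum Im_char_fun p)
  also have "(\<lambda>n. of_real (p n * (1 / (cmod (of_real (l n) - of_real x))\<^sup>2)) :: complex) =
     (\<lambda>n. of_real (p n) / (of_real (l n) - of_real x) / (of_real (l n) - of_real x))"
    by (simp flip: of_real_diff add: power2_eq_square)
  finally show ?thesis unfolding cauchy_sum_def by (simp add: infsumI)
qed

text \<open>At a real zero the derivative is a sum of terms of one sign, so all zeros are simple.\<close>

lemma char_fun_zero_simple:
  assumes p: "p summable_on UNIV" "same_sign p" and off: "\<And>n. p n \<noteq> 0 \<Longrightarrow> of_real (l n) \<noteq> \<mu>0"
    and zero: "char_fun p \<mu>0 = 0"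
  obtains x D where "\<mu>0 = of_real x" "D \<noteq> 0" "(char_fun p has_field_derivative of_real D) (at \<mu>0)"
proof -
  have nz: "\<exists>n. p n \<noteq> 0"
    by (rule ccontr) (use zero in \<open>simp add: char_fun_def cauchy_sum_def\<close>)
  then have "Im \<mu>0 = 0"
    using Im_char_fun_eq_0[OF p, of \<mu>0] zero by auto
  then have x: "\<mu>0 = of_real (Re \<mu>0)" by (simp add: complex_eq_iff)
  define D where "D = (\<Sum>\<^sub>\<infinity>n. p n * (1 / (cmod (of_real (l n) - \<mu>0))\<^sup>2))"
  have "D \<noteq> 0"
  proof
    assume D: "D = 0"
    obtain n where n: "p n \<noteq> 0" using nz by blast
    have "p n = 0"
      by (rule same_sign_infsum_eq_0[OF p(2) Im_char_fun(1)[OF p(1)] D[unfolded D_def]])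
        (use off[OF n] in auto)
    then show False using n by blast
  qed
  moreover have "(char_fun p has_field_derivative of_real D) (at \<mu>0)"
    using char_fun_derivative[OF p(1) off] char_fun_derivative_real[OF p(1), of "Re \<mu>0"]
    unfolding D_def x[symmetric] by simp
  ultimately show ?thesis using that x by blast
qed

lemma char_fun_real:
  assumes "p summable_on UNIV" shows "Im (char_fun p (of_real x)) = 0"
  using Im_char_fun(2)[OF assms, of "of_real x"] by simp

text \<open>On the positive imaginary axis every denominator has modulus at least \<open>y\<close>,
  so the sum is bounded by \<open>S / y\<close>.\<close>

lemma char_fun_at_imaginary_infinity:
  assumes p: "p summable_on UNIV"
  shows "((\<lambda>y. char_fun p (\<i> * of_real y)) \<longlongrightarrow> 1) at_top"
proof -
  define S where "S = (\<Sum>\<^sub>\<infinity>n. \<bar>p n\<bar>)"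
  have abs: "(\<lambda>n. \<bar>p n\<bar>) summable_on UNIV"
    using summable_on_iff_abs_summable_on_real[THEN iffD1, OF p] by simp
  have "\<forall>\<^sub>F y in at_top. cmod (cauchy_sum (\<lambda>n. of_real (p n)) (\<i> * of_real y)) \<le> S * (1 / y)"
    using eventually_gt_at_top[of 0]
  proof eventually_elim
    case (elim y)
    have term_le: "cmod (of_real (p n) / (of_real (l n) - \<i> * of_real y)) \<le> \<bar>p n\<bar> * (1 / y)" for n
    proof -
      have "y \<le> cmod (of_real (l n) - \<i> * of_real y)"
        using abs_Im_le_cmod[of "of_real (l n) - \<i> * of_real y"] elim by simp
      then have "\<bar>p n\<bar> / cmod (of_real (l n) - \<i> * of_real y) \<le> \<bar>p n\<bar> / y"
        using elim by (intro divide_left_mono) (auto intro: mult_pos_pos)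
      then show ?thesis by (simp add: norm_divide)
    qed
    have sum_l: "((\<lambda>n. of_real (p n) / (of_real (l n) - \<i> * of_real y)) has_sum
        cauchy_sum (\<lambda>n. of_real (p n)) (\<i> * of_real y)) UNIV"
      unfolding cauchy_sum_def
      by (rule has_sum_infsum[OF abs_summable_summable[OF cauchy_sum_abs_summable[OF abs_summable_of_real[OF p]]]])
    have sum_r: "((\<lambda>n. \<bar>p n\<bar> * (1 / y)) has_sum (\<Sum>\<^sub>\<infinity>n. \<bar>p n\<bar> * (1 / y))) UNIV"
      by (rule has_sum_infsum[OF summable_on_cmult_left[OF abs]])
    have "cmod (cauchy_sum (\<lambda>n. of_real (p n)) (\<i> * of_real y)) \<le> (\<Sum>\<^sub>\<infinity>n. \<bar>p n\<bar> * (1 / y))"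
      by (rule norm_infsum_le[OF sum_l sum_r]) (rule term_le)
    also have "\<dots> = S * (1 / y)" unfolding S_def by (rule infsum_cmult_left) (use abs in auto)
    finally show ?case .
  qed
  moreover have "((\<lambda>y. S * (1 / y)) \<longlongrightarrow> 0) at_top"
    using tendsto_mult_right_zero[OF tendsto_inverse_0_at_top[OF filterlim_ident], of S]
    by (simp add: divide_inverse)
  ultimately have "((\<lambda>y. cauchy_sum (\<lambda>n. of_real (p n)) (\<i> * of_real y)) \<longlongrightarrow> 0) at_top"
    by (rule Lim_null_comparison)
  then have "((\<lambda>y. 1 + cauchy_sum (\<lambda>n. of_real (p n)) (\<i> * of_real y)) \<longlongrightarrow> 1 + 0) at_top"
    by (intro tendsto_intros)
  then show ?thesis by (simp add: char_fun_def)
qed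

text \<open>At a common pole the limit is the quotient of the weights; at a common zero, which is
  simple for both functions, the quotient of the derivatives; elsewhere the quotient of the values.
  Each is nonzero, and real when \<open>\<mu>0\<close> is real.\<close>

lemma char_fun_ratio_limit:
  assumes p: "p summable_on UNIV" "same_sign p" and q: "q summable_on UNIV" "same_sign q"
    and supp: "\<And>n. p n = 0 \<longleftrightarrow> q n = 0"
    and zeros: "\<And>\<mu>. (\<And>n. p n \<noteq> 0 \<Longrightarrow> of_real (l n) \<noteq> \<mu>) \<Longrightarrow> char_fun p \<mu> = 0 \<longleftrightarrow> char_fun q \<mu> = 0"
  obtains L where "L \<noteq> 0" "((\<lambda>\<mu>. char_fun p \<mu> / char_fun q \<mu>) \<longlongrightarrow> L) (at \<mu>0)"
    "Im \<mu>0 = 0 \<Longrightarrow> Im L = 0"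
    "Im \<mu>0 \<noteq> 0 \<Longrightarrow> L = char_fun p \<mu>0 / char_fun q \<mu>0 \<and> (char_fun q \<mu>0 \<noteq> 0)"
    "\<And>m. of_real (l m) = \<mu>0 \<Longrightarrow> p m \<noteq> 0 \<Longrightarrow> L = of_real (p m / q m)"
proof (cases "\<exists>m. p m \<noteq> 0 \<and> of_real (l m) = \<mu>0")
  case True
  then obtain m where m: "p m \<noteq> 0" "of_real (l m) = \<mu>0" by blast
  have qm: "q m \<noteq> 0" using supp m by blast
  have lim: "((\<lambda>\<mu>. (of_real (l m) - \<mu>) * char_fun r \<mu>) \<longlongrightarrow> of_real (r m)) (at \<mu>0)"
    if "r summable_on UNIV" for r
    unfolding char_fun_def m(2)[symmetric]
    using cauchy_sum_pole[OF abs_summable_of_real[OF that]] by simp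
  have "((\<lambda>\<mu>. ((of_real (l m) - \<mu>) * char_fun p \<mu>) / ((of_real (l m) - \<mu>) * char_fun q \<mu>))
      \<longlongrightarrow> of_real (p m) / of_real (q m)) (at \<mu>0)"
    using qm by (intro tendsto_divide lim p q) auto
  moreover have "\<forall>\<^sub>F \<mu> in at \<mu>0. ((of_real (l m) - \<mu>) * char_fun p \<mu>) / ((of_real (l m) - \<mu>) * char_fun q \<mu>)
      = char_fun p \<mu> / char_fun q \<mu>"
    using eventually_no_point by eventually_elim simp
  ultimately have "((\<lambda>\<mu>. char_fun p \<mu> / char_fun q \<mu>) \<longlongrightarrow> of_real (p m) / of_real (q m)) (at \<mu>0)"
    by (rule Lim_transform_eventually)
  moreover have "Im \<mu>0 = 0" using m by auto
  ultimately show ?thesis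
    using m qm by (intro that[of "of_real (p m / q m)"]) (auto simp: point_inject)
next
  case False
  then have poff: "p n \<noteq> 0 \<Longrightarrow> of_real (l n) \<noteq> \<mu>0" and qoff: "q n \<noteq> 0 \<Longrightarrow> of_real (l n) \<noteq> \<mu>0" for n
    using supp by auto
  show ?thesis
  proof (cases "char_fun p \<mu>0 = 0")
    case True
    then have q0: "char_fun q \<mu>0 = 0" using zeros poff by blast
    obtain x D where D: "\<mu>0 = of_real x" "D \<noteq> 0" "(char_fun p has_field_derivative of_real D) (at \<mu>0)"
      using char_fun_zero_simple[OF p poff True] by blast
    obtain E where E: "E \<noteq> 0" "(char_fun q has_field_derivative of_real E) (at \<mu>0)"
      using char_fun_zero_simple[OF q qoff q0] by blast
    have "((\<lambda>\<mu>. (char_fun p \<mu> / (\<mu> - \<mu>0)) / (char_fun q \<mu> / (\<mu> - \<mu>0))) \<longlongrightarrow> of_real D / of_real E) (at \<mu>0)"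
      using D(3) E(2) E(1) unfolding has_field_derivative_iff True q0
      by (intro tendsto_divide) auto
    moreover have "\<forall>\<^sub>F \<mu> in at \<mu>0. (char_fun p \<mu> / (\<mu> - \<mu>0)) / (char_fun q \<mu> / (\<mu> - \<mu>0)) = char_fun p \<mu> / char_fun q \<mu>"
      using eventually_neq_at_within[of \<mu>0 \<mu>0 UNIV] by eventually_elim simp
    ultimately have "((\<lambda>\<mu>. char_fun p \<mu> / char_fun q \<mu>) \<longlongrightarrow> of_real D / of_real E) (at \<mu>0)"
      by (rule Lim_transform_eventually)
    then show ?thesis
      using D E poff by (intro that[of "of_real (D / E)"]) auto
  next
    case nz: False
    then have q0: "char_fun q \<mu>0 \<noteq> 0" using zeros poff by blast
    have "((\<lambda>\<mu>. char_fun p \<mu> / char_fun q \<mu>) \<longlongrightarrow> char_fun p \<mu>0 / char_fun q \<mu>0) (at \<mu>0)"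
      using char_fun_isCont[OF p(1) poff] char_fun_isCont[OF q(1) qoff] q0
      by (intro tendsto_divide) (auto simp: isCont_def)
    moreover have "Im (char_fun p \<mu>0 / char_fun q \<mu>0) = 0" if "Im \<mu>0 = 0"
    proof -
      have "\<mu>0 = of_real (Re \<mu>0)" using that by (simp add: complex_eq_iff)
      then have "Im (char_fun p \<mu>0) = 0" "Im (char_fun q \<mu>0) = 0"
        using char_fun_real p(1) q(1) by metis+
      then show ?thesis by (simp add: Im_divide)
    qed
    ultimately show ?thesis
      using nz q0 poff by (intro that[of "char_fun p \<mu>0 / char_fun q \<mu>0"]) auto
  qed
qed

text \<open>Meant for its imaginary part, where the real constant \<open>- r\<close> disappears: if
  the quotient of the two functions is \<open>- r\<close>, the function with weights
  \<open>p n + r * q n\<close> takes a real value.\<close>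

lemma char_fun_add_scaled:
  assumes p: "p summable_on UNIV" and q: "q summable_on UNIV"
  shows "char_fun (\<lambda>n. p n + r * q n) \<mu> = char_fun p \<mu> + of_real r * (char_fun q \<mu> - 1)"
proof -
  note s = abs_summable_summable[OF cauchy_sum_abs_summable[OF abs_summable_of_real]]
  have "((\<lambda>n. of_real (p n) / (of_real (l n) - \<mu>) + of_real r * (of_real (q n) / (of_real (l n) - \<mu>))) has_sum
     (cauchy_sum (\<lambda>n. of_real (p n)) \<mu> + of_real r * cauchy_sum (\<lambda>n. of_real (q n)) \<mu>)) UNIV"
    unfolding cauchy_sum_def
    by (intro has_sum_add has_sum_cmult_right has_sum_infsum s p q)
  then show ?thesis
    unfolding char_fun_def by (simp add: cauchy_sum_def add_divide_distrib infsumI)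
qed

text \<open>The quotient of the two functions extends to an entire function without zeros. Off the real axis
  it cannot attain \<open>- r\<close>, where \<open>r\<close> is its value at one of the common poles, since
  \<open>p + r q\<close> is of one sign again; on the real axis it keeps the sign of \<open>r\<close>.
  By Picard's little theorem it is constant.\<close>

theorem char_fun_zeros_determine:
  assumes p: "p summable_on UNIV" "same_sign p" and q: "q summable_on UNIV" "same_sign q"
    and supp: "\<And>n. p n = 0 \<longleftrightarrow> q n = 0"
    and zeros: "\<And>\<mu>. (\<And>n. p n \<noteq> 0 \<Longrightarrow> of_real (l n) \<noteq> \<mu>) \<Longrightarrow> char_fun p \<mu> = 0 \<longleftrightarrow> char_fun q \<mu> = 0"
  shows "p = q"
proof (cases "\<exists>m. p m \<noteq> 0")
  case False
  then show ?thesis using supp by auto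
next
  case True
  then obtain m where m: "p m \<noteq> 0" by blast
  define r where "r = p m / q m"
  have qm: "q m \<noteq> 0" and r: "r \<noteq> 0" using supp m by (auto simp: r_def)
  define f where "f = (\<lambda>\<mu>. char_fun p \<mu> / char_fun q \<mu>)"
  \<comment> \<open>At common zeros and at poles the value of \<open>f\<close> comes from division
    by zero and may differ from its limit; \<open>remove_sings\<close> puts the limit there.\<close>
  define R where "R = remove_sings f"
  note lim = char_fun_ratio_limit[OF p q supp zeros, folded f_def]
  have nz: "R \<mu> \<noteq> 0" for \<mu>
    by (rule lim[of \<mu>]) (auto simp: R_def dest: remove_sings_eqI)
  have real: "Im (R \<mu>) = 0" if "Im \<mu> = 0" for \<mu>
    by (rule lim[of \<mu>]) (use that in \<open>auto simp: R_def dest: remove_sings_eqI\<close>)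
  have nonreal: "R \<mu> = char_fun p \<mu> / char_fun q \<mu> \<and> char_fun q \<mu> \<noteq> 0" if "Im \<mu> \<noteq> 0" for \<mu>
    by (rule lim[of \<mu>]) (use that in \<open>auto simp: R_def dest: remove_sings_eqI\<close>)
  have pole: "R (of_real (l n)) = of_real (p n / q n)" if "p n \<noteq> 0" for n
    by (rule lim[of "of_real (l n)"]) (use that in \<open>auto simp: R_def dest: remove_sings_eqI\<close>)
  have "R analytic_on {\<mu>0}" for \<mu>0
  proof -
    obtain L where L: "L \<noteq> 0" "(f \<longlongrightarrow> L) (at \<mu>0)" by (rule lim[of \<mu>0])
    have "\<forall>\<^sub>F \<mu> in at \<mu>0. f \<mu> \<noteq> 0"
      by (rule tendsto_imp_eventually_ne[OF L(2,1)])
    then have "\<forall>\<^sub>F \<mu> in at \<mu>0. (\<forall>n. of_real (l n) \<noteq> \<mu>) \<and> char_fun q \<mu> \<noteq> 0"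
      using eventually_no_point by eventually_elim (auto simp: f_def)
    then obtain d where d: "d > 0" "\<And>\<mu>. \<mu> \<noteq> \<mu>0 \<Longrightarrow> dist \<mu> \<mu>0 < d \<Longrightarrow> (\<forall>n. of_real (l n) \<noteq> \<mu>) \<and> char_fun q \<mu> \<noteq> 0"
      unfolding eventually_at by blast
    have "f field_differentiable at \<mu>" if "\<mu> \<in> ball \<mu>0 d - {\<mu>0}" for \<mu>
    proof -
      have "(\<forall>n. of_real (l n) \<noteq> \<mu>) \<and> char_fun q \<mu> \<noteq> 0"
        using d(2)[of \<mu>] that by (auto simp: dist_commute)
      then show ?thesis
        unfolding f_def
        by (intro field_differentiable_divide)
          (use char_fun_derivative p(1) q(1) in \<open>auto simp: field_differentiable_def\<close>)
    qed
    then have "f holomorphic_on (ball \<mu>0 d - {\<mu>0})"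
      by (auto simp: holomorphic_on_def intro: field_differentiable_at_within)
    then have "isolated_singularity_at f \<mu>0"
      unfolding isolated_singularity_at_def using d(1)
      by (intro exI[of _ d]) (auto simp: analytic_on_open open_delete)
    then show ?thesis unfolding R_def using L(2) by (rule remove_sings_analytic_at)
  qed
  then have hol: "R holomorphic_on UNIV"
    by (metis analytic_imp_holomorphic analytic_on_analytic_at)
  have avoid: "R \<mu> \<noteq> - of_real r" for \<mu>
  proof (cases "Im \<mu> = 0")
    case False
    show ?thesis
    proof
      assume "R \<mu> = - of_real r"
      then have eq: "char_fun p \<mu> + of_real r * char_fun q \<mu> = 0"
        using nonreal[OF False] by (auto simp: field_simps)
      have sm: "(\<lambda>n. p n + r * q n) summable_on UNIV"
        by (intro summable_on_add summable_on_cmult_right p q)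
      \<comment> \<open>With \<open>r = p m / q m\<close>, every nonzero \<open>r * q n\<close> has
        the sign of \<open>p m\<close>, which is also that of every nonzero
        \<open>p n\<close>.\<close>
      have sgn: "(0 \<le> p n \<longleftrightarrow> 0 \<le> r * q n) \<and> (p n \<le> 0 \<longleftrightarrow> r * q n \<le> 0)" for n
      proof (cases "p n = 0")
        case True
        then show ?thesis using supp[of n] by simp
      next
        case False
        then have "q n \<noteq> 0" using supp by auto
        then have "0 < p n * p m" "0 < q n * q m"
          using p(2) q(2) m qm False unfolding same_sign_def
          by (metis less_eq_real_def mult_neg_neg mult_pos_pos)+
        then have "0 < (p n * p m) * (q n * q m)" by simp
        then have "0 < p n * (r * q n) * (q m)\<^sup>2"
          using qm by (simp add: r_def power2_eq_square mult_ac)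
        then have "0 < p n * (r * q n)"
          using qm by (simp add: zero_less_mult_iff)
        then show ?thesis unfolding zero_less_mult_iff[of "p n" "r * q n"] by linarith
      qed
      have ss: "same_sign (\<lambda>n. p n + r * q n)"
        using p(2) sgn unfolding same_sign_def by (meson add_nonneg_nonneg add_nonpos_nonpos)
      have "Im (char_fun (\<lambda>n. p n + r * q n) \<mu>) = 0"
        using arg_cong[OF eq, of Im] unfolding char_fun_add_scaled[OF p(1) q(1)] by simp
      \<comment> \<open>By the choice of \<open>r\<close> the left side is \<open>2 * p m\<close>,
        which is not 0.\<close>
      then have "p m + r * q m = 0"
        using Im_char_fun_eq_0[OF sm ss False] by blast
      then show False using m qm by (simp add: r_def)
    qed
  next
    case True
    \<comment> \<open>Intermediate values: on the real axis \<open>R\<close> is real and equals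
      \<open>r\<close> at the pole \<open>l m\<close>, so if it also took the value
      \<open>- r\<close> it would vanish in between.\<close>
    define g where "g = (\<lambda>x::real. Re (R (of_real x)))"
    have Rg: "R (of_real x) = of_real (g x)" for x
      using real[of "of_real x"] by (simp add: g_def complex_eq_iff)
    have "continuous_on UNIV g"
      unfolding g_def
      by (intro continuous_intros continuous_on_compose2[OF holomorphic_on_imp_continuous_on[OF hol]]) auto
    then have conn: "is_interval (range g)"
      by (metis connected_continuous_image connected_UNIV is_interval_connected_1)
    show ?thesis
    proof
      assume "R \<mu> = - of_real r"
      moreover have "\<mu> = of_real (Re \<mu>)" using True by (simp add: complex_eq_iff)
      ultimately have "of_real (g (Re \<mu>)) = (of_real (- r) :: complex)"
        using Rg[of "Re \<mu>"] by simp
      then have "- r \<in> range g" by (metis of_real_eq_iff rangeI)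
      moreover have "r \<in> range g"
        using pole[OF m] Rg[of "l m"] unfolding r_def by (metis of_real_eq_iff rangeI)
      ultimately have "0 \<in> range g"
        using conn unfolding is_interval_1 by (cases "r > 0") (smt (verit))+
      then show False using nz Rg by (metis (mono_tags) imageE of_real_0)
    qed
  qed
  \<comment> \<open>Since \<open>r \<noteq> 0\<close>, the omitted values 0 and \<open>- r\<close>
    are distinct.\<close>
  obtain c where c: "R = (\<lambda>_. c)"
    by (rule little_Picard[OF hol, of 0 "- of_real r"]) (use nz avoid r in \<open>auto simp: image_iff\<close>, metis)
  have "((\<lambda>y. char_fun p (\<i> * of_real y) / char_fun q (\<i> * of_real y)) \<longlongrightarrow> 1 / 1) at_top"
    by (intro tendsto_divide char_fun_at_imaginary_infinity p q) simp
  moreover have "\<forall>\<^sub>F y in at_top. char_fun p (\<i> * of_real y) / char_fun q (\<i> * of_real y) = c"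
    using eventually_gt_at_top[of 0]
  proof eventually_elim
    case (elim y)
    then show ?case using nonreal[of "\<i> * of_real y"] c by simp
  qed
  ultimately have "((\<lambda>y::real. c) \<longlongrightarrow> 1 / 1) at_top"
    by (rule Lim_transform_eventually)
  then have "c = 1" by (simp add: tendsto_const_iff)
  show ?thesis
  proof
    fix n
    show "p n = q n"
    proof (cases "p n = 0")
      case False
      then have "of_real (p n / q n) = (1 :: complex)" using pole[OF False] c \<open>c = 1\<close> by simp
      then have "p n / q n = 1" by (metis of_real_eq_1_iff)
      then show ?thesis by (auto simp: divide_eq_1_iff)
    qed (use supp in auto)
  qed
qed

end

section \<open>The unperturbed operator\<close>

definition lam :: "int \<Rightarrow> real" where
  "lam n = (2 * pi * of_int n) ^ 3"

lemma int_cube_separated: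
  fixes m n :: int
  assumes "m \<noteq> n" shows "1 \<le> \<bar>m ^ 3 - n ^ 3\<bar>"
proof -
  have "m ^ 3 \<noteq> n ^ 3"
  proof
    assume "m ^ 3 = n ^ 3"
    then have "root 3 (real_of_int m ^ 3) = root 3 (real_of_int n ^ 3)" by (simp flip: of_int_power)
    then have "real_of_int m = real_of_int n" unfolding odd_real_root_power_cancel[OF odd_numeral] .
    then show False using assms by simp
  qed
  then show ?thesis by linarith
qed

interpretation separated_points lam
proof
  fix m n :: int assume "m \<noteq> n"
  have "lam m - lam n = (2 * pi) ^ 3 * of_int (m ^ 3 - n ^ 3)"
    by (simp add: lam_def power_mult_distrib algebra_simps)
  moreover have "1 \<le> (2 * pi) ^ 3" using pi_ge_two by (intro one_le_power) linarith
  moreover have "1 \<le> \<bar>real_of_int (m ^ 3 - n ^ 3)\<bar>"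
    using int_cube_separated[OF \<open>m \<noteq> n\<close>] by linarith
  ultimately show "1 \<le> \<bar>lam m - lam n\<bar>"
    using mult_mono[of 1 "(2 * pi) ^ 3" 1 "\<bar>real_of_int (m ^ 3 - n ^ 3)\<bar>"] by (simp add: abs_mult)
qed

lemma lam_0: "lam n = 0 \<longleftrightarrow> n = 0"
  by (simp add: lam_def)

lemma fcoeff_0: "g \<in> L2 \<Longrightarrow> fcoeff g 0 = integral {0..1} g"
  by (simp add: fcoeff_def L2_inner_def integral_I01_eq L2_integrable)

lemma fcoeff_const: "fcoeff (\<lambda>x. c) n = (if n = 0 then c else 0)"
  using fcoeff_scale[of c "fexp 0" n] fcoeff_fexp[of 0 n] by (simp add: fexp_0(1)[abs_def])

lemma L2_const: "(\<lambda>x. c) \<in> L2"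
  by (intro L2_continuous continuous_intros)

lemma sobolev_deriv_primitive:
  assumes "g \<in> L2" shows "sobolev_deriv (\<lambda>x. c + integral {0..x} g) g"
  using assms by (simp add: sobolev_deriv_iff)

lemma sobolev_deriv_L2: "sobolev_deriv y g \<Longrightarrow> g \<in> L2"
  by (simp add: sobolev_deriv_def)

lemma sobolev_deriv_eq: "sobolev_deriv y g \<Longrightarrow> x \<in> {0..1} \<Longrightarrow> y x = y 0 + integral {0..x} g"
  unfolding sobolev_deriv_iff by blast

lemma sobolev_deriv_continuous: assumes "sobolev_deriv y g" shows "continuous_on {0..1} y"
proof -
  have "continuous_on {0..1} (\<lambda>x. y 0 + integral {0..x} g)"
    by (intro continuous_intros continuous_on_primitive sobolev_deriv_L2[OF assms])
  then show ?thesis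
    by (rule continuous_on_eq) (rule sym, erule sobolev_deriv_eq[OF assms])
qed

text \<open>Periodicity says that the mean of \<open>g\<close> vanishes, which removes the boundary
  term \<open>fcoeff g 0\<close> of \<open>fcoeff_primitive\<close>. The constant \<open>y 0\<close>
  contributes only at \<open>n = 0\<close>, where both sides are 0.\<close>

lemma fcoeff_sobolev_deriv:
  assumes y: "sobolev_deriv y g" and per: "y 1 = y 0"
  shows "fcoeff g n = 2 * pi * of_int n * \<i> * fcoeff y n"
proof -
  note g = sobolev_deriv_L2[OF y]
  have J: "(\<lambda>x. integral {0..x} g) \<in> L2" by (intro L2_continuous continuous_on_primitive g)
  note y_eq = sobolev_deriv_eq[OF y]
  have g0: "fcoeff g 0 = 0"
    using y_eq[of 1] per by (simp add: fcoeff_0[OF g])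
  have "fcoeff y n = fcoeff (\<lambda>x. y 0 + integral {0..x} g) n"
    unfolding fcoeff_def L2_inner_def
  proof (rule Bochner_Integration.integral_cong)
    fix x assume "x \<in> space I01"
    then show "y x * cnj (fexp n x) = (y 0 + integral {0..x} g) * cnj (fexp n x)"
      using y_eq[of x] by simp
  qed simp
  also have "\<dots> = (if n = 0 then y 0 else 0) + fcoeff (\<lambda>x. integral {0..x} g) n"
    by (simp add: fcoeff_add L2_const J fcoeff_const)
  finally show ?thesis
    using fcoeff_primitive[OF g, of n] g0 by (auto simp: distrib_left)
qed

text \<open>Vanishing mean of \<open>g\<close> is what makes a primitive periodic; the constant of
  integration is left to prescribe the mean of \<open>y\<close>.\<close>

lemma periodic_primitive_exists:
  assumes g: "g \<in> L2" and "fcoeff g 0 = 0"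
  obtains y where "sobolev_deriv y g" "y 1 = y 0" "fcoeff y 0 = c"
proof (rule that)
  let ?y = "\<lambda>x. (c - fcoeff (\<lambda>x. integral {0..x} g) 0) + integral {0..x} g"
  have J: "(\<lambda>x. integral {0..x} g) \<in> L2" by (intro L2_continuous continuous_on_primitive g)
  show "sobolev_deriv ?y g" by (rule sobolev_deriv_primitive[OF g])
  show "?y 1 = ?y 0" using assms by (simp add: fcoeff_0)
  show "fcoeff ?y 0 = c" by (simp add: fcoeff_add L2_const J fcoeff_const)
qed

lemma op_L0_D:
  assumes "(y, z) \<in> op_L0"
  shows "continuous_on {0..1} y" "y \<in> L2" "z \<in> L2" "\<And>x. x \<notin> {0..1} \<Longrightarrow> y x = 0"
    "fcoeff z n = of_real (lam n) * fcoeff y n"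
proof -
  obtain y1 y2 y3 where s: "sobolev_deriv y y1" "sobolev_deriv y1 y2" "sobolev_deriv y2 y3"
    and per: "y 1 = y 0" "y1 1 = y1 0" "y2 1 = y2 0"
    and out: "\<forall>x. x \<notin> {0..1} \<longrightarrow> y x = 0" and z: "z \<in> L2" "AE x in I01. z x = \<i> * y3 x"
    using assms unfolding op_L0_def by blast
  show "continuous_on {0..1} y" by (rule sobolev_deriv_continuous[OF s(1)])
  then show "y \<in> L2" by (rule L2_continuous)
  show "z \<in> L2" by fact
  show "\<And>x. x \<notin> {0..1} \<Longrightarrow> y x = 0" using out by blast
  have "fcoeff z n = \<i> * fcoeff y3 n"
    using fcoeff_cong_AE[OF z(1) L2_scale[OF sobolev_deriv_L2[OF s(3)]] z(2)] by (simp add: fcoeff_scale)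
  also have "\<dots> = \<i> * (2 * pi * of_int n * \<i>) ^ 3 * fcoeff y n"
    using fcoeff_sobolev_deriv[OF s(1) per(1), of n] fcoeff_sobolev_deriv[OF s(2) per(2), of n]
      fcoeff_sobolev_deriv[OF s(3) per(3), of n] by (simp add: power3_eq_cube)
  also have "\<i> * (2 * pi * of_int n * \<i>) ^ 3 = (2 * pi * of_int n) ^ 3 * (\<i> * \<i> ^ 3)"
    by (subst power_mult_distrib[of _ \<i>]) (simp only: mult_ac of_real_power)
  also have "\<dots> = of_real (lam n)" by (simp add: lam_def power3_eq_cube)
  finally show "fcoeff z n = of_real (lam n) * fcoeff y n" .
qed

text \<open>Three integrations. The intermediate primitives get mean 0, so that each has a periodic
  primitive again; the last mean is free because \<open>op_L0\<close> annihilates constants.\<close>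

lemma op_L0_exists:
  assumes z: "z \<in> L2" and "fcoeff z 0 = 0"
  obtains y where "(y, z) \<in> op_L0" "fcoeff y 0 = c"
proof -
  define y3 where "y3 = (\<lambda>x. - \<i> * z x)"
  have "fcoeff y3 0 = 0"
    unfolding y3_def fcoeff_scale using assms by simp
  moreover have "y3 \<in> L2" unfolding y3_def by (rule L2_scale[OF z])
  ultimately obtain y2 where y2: "sobolev_deriv y2 y3" "y2 1 = y2 0" "fcoeff y2 0 = 0"
    using periodic_primitive_exists by blast
  have "y2 \<in> L2" by (rule L2_continuous[OF sobolev_deriv_continuous[OF y2(1)]])
  then obtain y1 where y1: "sobolev_deriv y1 y2" "y1 1 = y1 0" "fcoeff y1 0 = 0"
    using y2(3) by (rule periodic_primitive_exists)
  have "y1 \<in> L2" by (rule L2_continuous[OF sobolev_deriv_continuous[OF y1(1)]])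
  then obtain y where y: "sobolev_deriv y y1" "y 1 = y 0" "fcoeff y 0 = c"
    using y1(3) by (rule periodic_primitive_exists)
  \<comment> \<open>The graph contains only functions that vanish outside
    \<open>{0..1}\<close>.\<close>
  define y' where "y' = (\<lambda>x. if x \<in> {0..1} then y x else 0)"
  have "sobolev_deriv y' y1"
    unfolding sobolev_deriv_iff
  proof (intro conjI ballI)
    fix x :: real assume x: "x \<in> {0..1}"
    then show "y' x = y' 0 + integral {0..x} y1"
      using sobolev_deriv_eq[OF y(1) x] by (simp add: y'_def)
  qed fact
  then have "(y', z) \<in> op_L0"
    unfolding op_L0_def mem_Collect_eq prod.case using y2(1,2) y1(1,2) y(2) z
    by - (rule exI[of _ y1], rule exI[of _ y2], rule exI[of _ y3], simp add: y3_def y'_def)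
  moreover have "fcoeff y' 0 = fcoeff y 0"
    unfolding fcoeff_def L2_inner_def
    by (rule Bochner_Integration.integral_cong) (auto simp: y'_def)
  ultimately show ?thesis using that y(3) by simp
qed

lemma sobolev_deriv_linear:
  assumes "sobolev_deriv y g" "sobolev_deriv y' g'"
  shows "sobolev_deriv (\<lambda>x. c * y x + d * y' x) (\<lambda>x. c * g x + d * g' x)"
  unfolding sobolev_deriv_iff
proof (intro conjI ballI)
  note g = assms[THEN sobolev_deriv_L2]
  show "(\<lambda>x. c * g x + d * g' x) \<in> L2" by (intro L2_add L2_scale g)
  fix x :: real assume x: "x \<in> {0..1}"
  have "integral {0..x} (\<lambda>x. c * g x + d * g' x) = integral {0..x} (\<lambda>x. c * g x) + integral {0..x} (\<lambda>x. d * g' x)"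
    by (rule Henstock_Kurzweil_Integration.integral_add) (use x in \<open>auto intro!: L2_integrable_on L2_scale g\<close>)
  also have "\<dots> = c * integral {0..x} g + d * integral {0..x} g'" by simp
  finally have i: "integral {0..x} (\<lambda>x. c * g x + d * g' x) = c * integral {0..x} g + d * integral {0..x} g'" .
  have "y x = y 0 + integral {0..x} g" "y' x = y' 0 + integral {0..x} g'"
    by (rule sobolev_deriv_eq[OF assms(1) x], rule sobolev_deriv_eq[OF assms(2) x])
  then show "c * y x + d * y' x = c * y 0 + d * y' 0 + integral {0..x} (\<lambda>x. c * g x + d * g' x)"
    unfolding i by (simp add: algebra_simps)
qed

lemma op_L0_linear:
  assumes "(y, z) \<in> op_L0" "(y', z') \<in> op_L0"
  shows "((\<lambda>x. c * y x + d * y' x), (\<lambda>x. c * z x + d * z' x)) \<in> op_L0"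
proof -
  obtain y1 y2 y3 where s: "sobolev_deriv y y1" "sobolev_deriv y1 y2" "sobolev_deriv y2 y3"
    and per: "y 1 = y 0" "y1 1 = y1 0" "y2 1 = y2 0"
    and out: "\<forall>x. x \<notin> {0..1} \<longrightarrow> y x = 0" and z: "z \<in> L2" "AE x in I01. z x = \<i> * y3 x"
    using assms unfolding op_L0_def by blast
  obtain y1' y2' y3' where s': "sobolev_deriv y' y1'" "sobolev_deriv y1' y2'" "sobolev_deriv y2' y3'"
    and per': "y' 1 = y' 0" "y1' 1 = y1' 0" "y2' 1 = y2' 0"
    and out': "\<forall>x. x \<notin> {0..1} \<longrightarrow> y' x = 0" and z': "z' \<in> L2" "AE x in I01. z' x = \<i> * y3' x"
    using assms unfolding op_L0_def by blast
  have "AE x in I01. c * z x + d * z' x = \<i> * (c * y3 x + d * y3' x)"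
    using z(2) z'(2) by eventually_elim (simp add: algebra_simps)
  moreover have "(\<lambda>x. c * z x + d * z' x) \<in> L2" by (intro L2_add L2_scale z z')
  ultimately show ?thesis
    unfolding op_L0_def using per per' out out'
      sobolev_deriv_linear[OF s(1) s'(1), of c d] sobolev_deriv_linear[OF s(2) s'(2), of c d]
      sobolev_deriv_linear[OF s(3) s'(3), of c d]
    by (intro CollectI case_prodI exI conjI) (assumption | simp)+
qed

lemma continuous_AE_eq_0:
  fixes f :: "real \<Rightarrow> complex"
  assumes f: "continuous_on {0..1} f" "AE x in I01. f x = 0" and x: "x \<in> {0..1}"
  shows "f x = 0"
proof -
  have c: "continuous_on {0..1} (\<lambda>x. cmod (f x))" by (intro continuous_intros f)
  have "(\<integral>x. cmod (f x) \<partial>I01) = (\<integral>x. 0 \<partial>I01)"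
    using f(2) measurable_I01_continuous[OF c] by (intro integral_cong_AE) auto
  then have "integral {0..1} (\<lambda>x. cmod (f x)) = 0"
    using integral_I01_eq[OF integrable_I01_continuous[OF c]] by simp
  then have "\<forall>x\<in>{0..1}. cmod (f x) = 0"
    using integral_eq_0_iff[OF c] by simp
  then show ?thesis using x by auto
qed

text \<open>Almost everywhere equality becomes equality of functions, since both are continuous on
  \<open>{0..1}\<close> and vanish outside. This lets dimensions of eigenspaces be computed in a
  space of functions rather than of classes.\<close>

lemma op_L0_unique:
  assumes y: "(y, z) \<in> op_L0" and y': "(y', z') \<in> op_L0" and eq: "\<And>n. fcoeff y n = fcoeff y' n"
  shows "y = y'"
proof
  fix x
  note D = op_L0_D[OF y] and D' = op_L0_D[OF y']
  have "AE x in I01. y x - y' x = 0"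
    using fcoeff_unique[OF D(2) D'(2) eq] by eventually_elim simp
  then have "x \<in> {0..1} \<Longrightarrow> y x - y' x = 0"
    by (intro continuous_AE_eq_0[of "\<lambda>x. y x - y' x"] continuous_intros D(1) D'(1))
  then show "y x = y' x" using D(4) D'(4) by (cases "x \<in> {0..1}") auto
qed

text \<open>Summability of \<open>1 / n\<^sup>2\<close> over the integers is read off from the Fourier coefficients of the
  identity function.\<close>

lemma summable_inverse_square: "(\<lambda>n::int. 1 / (2 * pi * of_int n)\<^sup>2) summable_on UNIV"
proof -
  define J :: "real \<Rightarrow> complex" where "J = (\<lambda>x. integral {0..x} (\<lambda>_. 1))"
  have "J \<in> L2" unfolding J_def by (intro L2_continuous continuous_on_primitive L2_const)
  then have "(\<lambda>n. (cmod (fcoeff J n))\<^sup>2) summable_on UNIV"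
    using parseval has_sum_imp_summable by blast
  moreover have "norm (1 / (2 * pi * of_int n)\<^sup>2) \<le> (cmod (fcoeff J n))\<^sup>2" for n :: int
  proof (cases "n = 0")
    case False
    have "2 * pi * of_int n * \<i> * fcoeff J n = -1"
      using fcoeff_primitive[OF L2_const[of 1], of n] False by (simp add: J_def fcoeff_const)
    then have "fcoeff J n = -1 / (2 * pi * of_int n * \<i>)"
      using False by (simp add: field_simps)
    then have "cmod (fcoeff J n) = 1 / (2 * pi * \<bar>of_int n\<bar>)"
      by (simp add: norm_divide norm_mult)
    then show ?thesis by (simp add: power_divide power_mult_distrib)
  qed simp
  ultimately have "(\<lambda>n. norm (1 / (2 * pi * of_int n)\<^sup>2)) summable_on (UNIV :: int set)"
    by (rule Infinite_Sum.abs_summable_on_comparison_test')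
  then show ?thesis by (rule abs_summable_summable)
qed

text \<open>For \<open>n \<noteq> 0\<close> one has \<open>(2 pi n)^2 \<le> |lam n|\<close>. At
  \<open>n = 0\<close>, where \<open>lam n = 0\<close> gives no control and \<open>1 / 0 = 0\<close>
  makes the main majorant vanish, \<open>cmod (a 0)\<close> is added by hand.\<close>

lemma summable_of_lam_bounded:
  assumes B: "\<And>n. cmod (of_real (lam n) * a n) \<le> B"
  shows "(\<lambda>n. cmod (a n)) summable_on UNIV"
proof (rule Infinite_Sum.abs_summable_on_comparison_test')
  have "((\<lambda>n::int. if n = 0 then cmod (a 0) else 0) has_sum cmod (a 0)) UNIV"
    by (rule has_sum_finite_neutralI[of "{0}"]) auto
  then show "(\<lambda>n. B * (1 / (2 * pi * of_int n)\<^sup>2) + (if n = 0 then cmod (a 0) else 0)) summable_on UNIV"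
    by (intro summable_on_add summable_on_cmult_right summable_inverse_square) (rule has_sum_imp_summable)
  fix n :: int
  show "cmod (a n) \<le> B * (1 / (2 * pi * of_int n)\<^sup>2) + (if n = 0 then cmod (a 0) else 0)"
  proof (cases "n = 0")
    case False
    have "1 \<le> 2 * pi * \<bar>real_of_int n\<bar>"
      using mult_mono[of 1 "2 * pi" 1 "\<bar>real_of_int n\<bar>"] False pi_ge_two by simp
    then have "(2 * pi * \<bar>real_of_int n\<bar>)\<^sup>2 \<le> (2 * pi * \<bar>real_of_int n\<bar>) ^ 3"
      by (intro power_increasing) auto
    then have "(2 * pi * real_of_int n)\<^sup>2 \<le> \<bar>lam n\<bar>"
      by (simp add: lam_def power_abs abs_mult power_mult_distrib)
    then have "(2 * pi * real_of_int n)\<^sup>2 * cmod (a n) \<le> \<bar>lam n\<bar> * cmod (a n)"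
      by (rule mult_right_mono) simp
    also have "\<dots> \<le> B" using B[of n] by (simp add: norm_mult)
    finally show ?thesis using False by (simp add: field_simps)
  qed simp
qed

lemma fcoeff_bounded:
  assumes "f \<in> L2" obtains B where "\<And>n. cmod (fcoeff f n) \<le> B"
proof (rule that)
  fix n
  have "(cmod (fcoeff f n))\<^sup>2 \<le> (\<integral>x. (cmod (f x))\<^sup>2 \<partial>I01)"
    using bessel[OF assms, of "{n}"] by simp
  then show "cmod (fcoeff f n) \<le> sqrt (\<integral>x. (cmod (f x))\<^sup>2 \<partial>I01)"
    by (rule real_le_rsqrt)
qed

text \<open>Membership in the domain yields absolute summability: \<open>lam n * fcoeff y n\<close>
  is a coefficient of \<open>z\<close> and hence bounded.\<close>

lemma op_L0_inner_has_sum: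
  assumes y: "(y, z) \<in> op_L0" and v: "v \<in> L2"
  shows "((\<lambda>n. fcoeff y n * cnj (fcoeff v n)) has_sum L2_inner y v) UNIV"
proof -
  obtain B where "\<And>n. cmod (fcoeff z n) \<le> B" using fcoeff_bounded[OF op_L0_D(3)[OF y]] by blast
  then have "(\<lambda>n. cmod (fcoeff y n)) summable_on UNIV"
    unfolding op_L0_D(5)[OF y] by (rule summable_of_lam_bounded)
  then show ?thesis using L2_inner_has_sum op_L0_D(2)[OF y] v by blast
qed

text \<open>Fredholm alternative for the unperturbed operator, read on coefficients. Division by
  zero sets a resonant coefficient to 0, which selects the solution without component in the
  eigenspace at \<open>\<mu>\<close>.\<close>

lemma op_L0_solve:
  assumes f: "f \<in> L2" and f0: "\<And>n. of_real (lam n) = \<mu> \<Longrightarrow> fcoeff f n = 0"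
  obtains y z where "(y, z) \<in> op_L0" "\<And>n. fcoeff y n = fcoeff f n / (of_real (lam n) - \<mu>)"
proof -
  define a where "a = (\<lambda>n. fcoeff f n / (of_real (lam n) - \<mu>))"
  have a_eq: "of_real (lam n) * a n = \<mu> * a n + fcoeff f n" for n
    using f0[of n] by (cases "of_real (lam n) = \<mu>") (auto simp: a_def field_simps)
  obtain B where B: "\<And>n. cmod (fcoeff f n) \<le> B" using fcoeff_bounded[OF f] by blast
  obtain d where d: "d > 0" "\<And>n. of_real (lam n) \<noteq> \<mu> \<Longrightarrow> d \<le> cmod (of_real (lam n) - \<mu>)"
    using distance_pos[of \<mu>] by blast
  have "B \<ge> 0" using B[of 0] norm_ge_zero order_trans by blast
  have "cmod (a n) \<le> B / d" for n
  proof (cases "of_real (lam n) = \<mu>")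
    case False
    then show ?thesis
      unfolding a_def norm_divide using B[of n] d(1) d(2)[OF False] \<open>B \<ge> 0\<close> by (intro frac_le)
  qed (use d \<open>B \<ge> 0\<close> in \<open>simp add: a_def\<close>)
  then have "cmod (\<mu> * a n) \<le> cmod \<mu> * (B / d)" for n
    unfolding norm_mult by (intro mult_left_mono) auto
  then have "cmod (of_real (lam n) * a n) \<le> cmod \<mu> * (B / d) + B" for n
    unfolding a_eq by (intro order_trans[OF norm_triangle_ineq] add_mono B)
  then have "(\<lambda>n. cmod (a n)) summable_on UNIV" by (rule summable_of_lam_bounded)
  then obtain s where s: "continuous_on UNIV s" "\<And>n. fcoeff s n = a n"
    by (rule fourier_series) (rule that, assumption+)
  have sL: "s \<in> L2" by (rule L2_continuous[OF continuous_on_subset[OF s(1)]]) simp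
  \<comment> \<open>The equation prescribes the image of the solution. With \<open>s\<close> in
    place of \<open>y\<close> it has the coefficients \<open>lam n * a n\<close>, in particular mean
    0, so that \<open>op_L0_exists\<close> applies.\<close>
  define z where "z = (\<lambda>x. \<mu> * s x + f x)"
  have z: "z \<in> L2" unfolding z_def by (intro L2_add L2_scale sL f)
  have zn: "fcoeff z n = of_real (lam n) * a n" for n
    unfolding z_def by (simp add: fcoeff_add L2_scale sL f fcoeff_scale s(2) a_eq)
  obtain y where y: "(y, z) \<in> op_L0" "fcoeff y 0 = a 0"
    using op_L0_exists[OF z, of "a 0"] zn[of 0] lam_0 by auto
  have "fcoeff y n = a n" for n
    using op_L0_D(5)[OF y(1), of n] zn[of n] y(2) lam_0[of n] by (cases "n = 0") auto
  then show ?thesis using that[OF y(1)] by (simp add: a_def)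
qed

text \<open>On \<open>{0..1}\<close> this is \<open>fexp k\<close>; \<open>op_L0_exists\<close>
  supplies the representative that vanishes outside.\<close>

lemma op_L0_eigenfunction:
  obtains e z where "(e, z) \<in> op_L0" "\<And>n. fcoeff e n = (if n = k then 1 else 0)"
proof -
  define z where "z = (\<lambda>x. of_real (lam k) * fexp k x)"
  have z: "z \<in> L2" unfolding z_def by (intro L2_scale fexp_L2)
  have zn: "fcoeff z n = (if n = k then of_real (lam k) else 0)" for n
    by (simp add: z_def fcoeff_scale fcoeff_fexp)
  have "fcoeff z 0 = 0" using zn[of 0] lam_0 by auto
  then obtain e where e: "(e, z) \<in> op_L0" "fcoeff e 0 = (if 0 = k then 1 else 0)"
    using op_L0_exists[OF z, of "if 0 = k then 1 else 0"] by blast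
  have "fcoeff e n = (if n = k then 1 else 0)" for n
  proof (cases "n = 0")
    case True
    then show ?thesis using e(2) by simp
  next
    case False
    then have "of_real (lam n) \<noteq> (0 :: complex)" using lam_0 by simp
    then show ?thesis
      using op_L0_D(5)[OF e(1), of n] unfolding zn by (cases "n = k") simp_all
  qed
  then show ?thesis using that e(1) by blast
qed

text \<open>Uniqueness of Fourier coefficients decouples the eigenvalue equation; the indices
  interact only through the number \<open>L2_inner y v\<close>.\<close>

lemma eigenspace_iff:
  assumes v: "v \<in> L2"
  shows "y \<in> eigenspace (op_L \<alpha> v) \<mu> \<longleftrightarrow>
    (\<exists>z. (y, z) \<in> op_L0) \<and> (\<forall>n. (of_real (lam n) - \<mu>) * fcoeff y n = - of_real \<alpha> * L2_inner y v * fcoeff v n)"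
    (is "?lhs \<longleftrightarrow> ?rhs")
proof
  assume ?lhs
  then obtain w z where w: "(y, z) \<in> op_L0" "w \<in> L2"
    "AE x in I01. w x = z x + of_real \<alpha> * L2_inner y v * v x" "AE x in I01. w x = \<mu> * y x"
    unfolding eigenspace_def op_L_def by auto
  note D = op_L0_D[OF w(1)]
  have "AE x in I01. z x + of_real \<alpha> * L2_inner y v * v x = \<mu> * y x"
    using w(3,4) by eventually_elim simp
  then have "fcoeff (\<lambda>x. z x + of_real \<alpha> * L2_inner y v * v x) n = fcoeff (\<lambda>x. \<mu> * y x) n" for n
    by (rule fcoeff_cong_AE[OF L2_add[OF D(3) L2_scale[OF v]] L2_scale[OF D(2)]])
  then have "of_real (lam n) * fcoeff y n + of_real \<alpha> * L2_inner y v * fcoeff v n = \<mu> * fcoeff y n" for n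
    by (simp add: fcoeff_add fcoeff_scale L2_scale D(2,3,5) v)
  then have "(of_real (lam n) - \<mu>) * fcoeff y n = - of_real \<alpha> * L2_inner y v * fcoeff v n" for n
    by (simp add: left_diff_distrib diff_eq_eq flip: eq_diff_eq)
  then show ?rhs using w(1) by blast
next
  assume ?rhs
  then obtain z where z: "(y, z) \<in> op_L0"
    and eq: "\<And>n. (of_real (lam n) - \<mu>) * fcoeff y n = - of_real \<alpha> * L2_inner y v * fcoeff v n" by blast
  note D = op_L0_D[OF z]
  have "AE x in I01. \<mu> * y x = z x + of_real \<alpha> * L2_inner y v * v x"
  proof (rule fcoeff_unique)
    show "fcoeff (\<lambda>x. \<mu> * y x) n = fcoeff (\<lambda>x. z x + of_real \<alpha> * L2_inner y v * v x) n" for n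
    proof -
      have "fcoeff (\<lambda>x. z x + of_real \<alpha> * L2_inner y v * v x) n =
          of_real (lam n) * fcoeff y n + of_real \<alpha> * L2_inner y v * fcoeff v n"
        by (simp add: fcoeff_add fcoeff_scale L2_scale D(2,3,5) v)
      then show ?thesis using eq[of n] by (simp add: fcoeff_scale left_diff_distrib diff_eq_eq)
    qed
  qed (intro L2_add L2_scale D(2,3) v)+
  then show ?lhs
    unfolding eigenspace_def op_L_def using z L2_scale[OF D(2), of \<mu>]
    by (intro CollectI exI[of _ "\<lambda>x. \<mu> * y x"]) auto
qed

section \<open>Multiplicities and recovery of the potential\<close>

interpretation fs: vector_space fun_scale
  by (rule vector_space_fun_scale)

lemma combination_in_span:
  assumes "f \<in> B" "g \<in> B" shows "(\<lambda>x. c * f x + d * g x) \<in> fs.span B"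
proof -
  have "(\<lambda>x. c * f x + d * g x) = fun_scale c f + fun_scale d g"
    by (auto simp: fun_scale_def)
  then show ?thesis using assms by (auto intro: fs.span_add fs.span_scale fs.span_base)
qed

lemma op_L0_zero: "((\<lambda>x. 0), (\<lambda>x. 0)) \<in> op_L0"
proof -
  obtain y z where "(y, z) \<in> op_L0" by (rule op_L0_eigenfunction)
  from op_L0_linear[OF this this, of 0 0] show ?thesis by simp
qed

lemma fcoeff_combination:
  "y \<in> L2 \<Longrightarrow> y' \<in> L2 \<Longrightarrow> fcoeff (\<lambda>x. c * y x + d * y' x) n = c * fcoeff y n + d * fcoeff y' n"
  by (simp add: fcoeff_add L2_scale fcoeff_scale)

definition weights :: "real \<Rightarrow> (real \<Rightarrow> complex) \<Rightarrow> int \<Rightarrow> real" where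
  "weights \<alpha> v n = \<alpha> * (cmod (fcoeff v n))\<^sup>2"

lemma weights_has_sum: "v \<in> L2 \<Longrightarrow> (weights \<alpha> v has_sum \<alpha> * (L2_norm v)\<^sup>2) UNIV"
  unfolding weights_def[abs_def] L2_norm_square by (intro has_sum_cmult_right parseval)

lemma same_sign_weights: "same_sign (weights \<alpha> v)"
  by (cases "\<alpha> \<ge> 0") (auto simp: same_sign_def weights_def mult_nonpos_nonneg)

lemma weights_eq_0: "weights \<alpha> v n = 0 \<longleftrightarrow> of_real \<alpha> * fcoeff v n = 0"
  by (simp add: weights_def)

text \<open>The equation at index \<open>m\<close> forces \<open>L2_inner y v = 0\<close>. Then all
  other coefficients vanish because the points \<open>lam n\<close> are distinct, and orthogonality
  to \<open>v\<close> removes the one at \<open>m\<close>.\<close>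

lemma multiplicity_at_pole:
  assumes v: "v \<in> L2" and m: "weights \<alpha> v m \<noteq> 0"
  shows "multiplicity_of (op_L \<alpha> v) (of_real (lam m)) = 0"
proof -
  have "y = 0" if y: "y \<in> eigenspace (op_L \<alpha> v) (of_real (lam m))" for y
  proof -
    obtain z where z: "(y, z) \<in> op_L0"
      and eq: "\<And>n. (of_real (lam n) - of_real (lam m)) * fcoeff y n = - of_real \<alpha> * L2_inner y v * fcoeff v n"
      using y unfolding eigenspace_iff[OF v] by blast
    have c: "L2_inner y v = 0" using eq[of m] m by (simp add: weights_def)
    have off: "fcoeff y n = 0" if "n \<noteq> m" for n
      using eq[of n] that c by (simp add: point_inject)
    have "((\<lambda>n. fcoeff y n * cnj (fcoeff v n)) has_sum fcoeff y m * cnj (fcoeff v m)) UNIV"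
      by (rule has_sum_finite_neutralI[of "{m}"]) (auto simp: off)
    then have "fcoeff y m * cnj (fcoeff v m) = 0"
      using op_L0_inner_has_sum[OF z v] c has_sum_unique by metis
    then have "fcoeff y m = 0" using m by (simp add: weights_def)
    then have "fcoeff y n = fcoeff (\<lambda>x. 0) n" for n
      using off by (cases "n = m") (auto simp: fcoeff_const)
    then show "y = 0" using op_L0_unique[OF z op_L0_zero] by (auto simp: zero_fun_def)
  qed
  moreover have "0 \<in> eigenspace (op_L \<alpha> v) (of_real (lam m))"
    unfolding eigenspace_iff[OF v] using op_L0_zero
    by (auto simp: zero_fun_def fcoeff_const L2_inner_def)
  ultimately have "eigenspace (op_L \<alpha> v) (of_real (lam m)) \<subseteq> fs.span {}" by auto
  then show ?thesis
    unfolding multiplicity_of_def using fs.dim_unique[OF empty_subsetI _ fs.independent_empty] by simp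
qed

text \<open>Let \<open>u\<close> solve the unperturbed equation at \<open>\<mu>\<close> with
  right-hand side \<open>\<alpha> v\<close>, and let \<open>e\<close> be the unperturbed
  eigenfunction at \<open>\<mu>\<close>, or 0 if there is none. Every eigenfunction is
  \<open>y = - <y, v> u + d e\<close>. Since \<open><u, v> = F - 1\<close>, pairing with
  \<open>v\<close> gives \<open><y, v> F = d <e, v>\<close>, where
  \<open>\<alpha> <e, v> = 0\<close>; hence \<open>u\<close> contributes exactly when
  \<open>F = 0\<close>.\<close>

lemma multiplicity_formula:
  assumes v: "v \<in> L2" and off: "\<And>n. weights \<alpha> v n \<noteq> 0 \<Longrightarrow> of_real (lam n) \<noteq> \<mu>"
  shows "multiplicity_of (op_L \<alpha> v) \<mu> =
    (if char_fun (weights \<alpha> v) \<mu> = 0 then 1 else 0) + (if \<exists>k. of_real (lam k) = \<mu> then 1 else 0)"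
proof -
  define E where "E = eigenspace (op_L \<alpha> v) \<mu>"
  define F where "F = char_fun (weights \<alpha> v) \<mu>"
  have off': "of_real \<alpha> * fcoeff v n = 0" if "of_real (lam n) = \<mu>" for n
    using off[of n] that by (auto simp: weights_eq_0)
  have src: "fcoeff (\<lambda>x. of_real \<alpha> * v x) n = 0" if "of_real (lam n) = \<mu>" for n
    using off'[OF that] by (simp add: fcoeff_scale)
  obtain u zu where u_src: "(u, zu) \<in> op_L0"
      "\<And>n. fcoeff u n = fcoeff (\<lambda>x. of_real \<alpha> * v x) n / (of_real (lam n) - \<mu>)"
    by (rule op_L0_solve[where \<mu> = \<mu>, OF L2_scale[OF v, of "of_real \<alpha>"]]) (erule src, rule that, assumption+)
  note u = u_src(1) u_src(2)[unfolded fcoeff_scale]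
  note uL = op_L0_D(2)[OF u(1)]
  have "\<exists>e z. (e, z) \<in> op_L0 \<and> (\<forall>n. fcoeff e n = (if of_real (lam n) = \<mu> then 1 else 0))"
  proof (cases "\<exists>k. of_real (lam k) = \<mu>")
    case True
    then obtain k where k: "of_real (lam k) = \<mu>" by blast
    have "of_real (lam n) = \<mu> \<longleftrightarrow> n = k" for n by (simp add: k[symmetric] point_inject)
    then show ?thesis using op_L0_eigenfunction[of k] by metis
  next
    case False
    then show ?thesis using op_L0_zero by (intro exI[of _ "\<lambda>x. 0"]) (auto simp: fcoeff_const)
  qed
  then obtain e ze where e: "(e, ze) \<in> op_L0" "\<And>n. fcoeff e n = (if of_real (lam n) = \<mu> then 1 else 0)"
    by blast
  note eL = op_L0_D(2)[OF e(1)]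
  have uv: "L2_inner u v = F - 1"
  proof -
    have "fcoeff u n * cnj (fcoeff v n) = of_real (weights \<alpha> v n) / (of_real (lam n) - \<mu>)" for n
      by (simp add: u(2) weights_def complex_norm_square del: of_real_power)
    then have "L2_inner u v = cauchy_sum (\<lambda>n. of_real (weights \<alpha> v n)) \<mu>"
      unfolding cauchy_sum_def using op_L0_inner_has_sum[OF u(1) v] by (simp add: infsumI)
    then show ?thesis by (simp add: F_def char_fun_def)
  qed
  \<comment> \<open>At a resonant index only \<open>\<alpha> * fcoeff v n = 0\<close> is known; for
    \<open>\<alpha> = 0\<close> the inner product itself may be nonzero, hence the factor.\<close>
  have ev: "of_real \<alpha> * L2_inner e v = 0"
  proof -
    have "(\<lambda>n. of_real \<alpha> * (fcoeff e n * cnj (fcoeff v n))) = (\<lambda>n. 0)"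
      using off' by (auto simp: e(2))
    then show ?thesis
      using has_sum_cmult_right[OF op_L0_inner_has_sum[OF e(1) v], of "of_real \<alpha>"] has_sum_unique has_sum_0_simp by metis
  qed
  have u_res: "fcoeff u n = 0" if "of_real (lam n) = \<mu>" for n using that by (simp add: u(2))
  have u_E: "u \<in> E" if "F = 0"
    unfolding E_def eigenspace_iff[OF v]
  proof (intro conjI allI)
    show "(of_real (lam n) - \<mu>) * fcoeff u n = - of_real \<alpha> * L2_inner u v * fcoeff v n" for n
      using off'[of n] by (cases "of_real (lam n) = \<mu>") (auto simp: u(2) uv that)
  qed (use u(1) in blast)
  have e_E: "e \<in> E"
    unfolding E_def eigenspace_iff[OF v]
  proof (intro conjI allI)
    show "(of_real (lam n) - \<mu>) * fcoeff e n = - of_real \<alpha> * L2_inner e v * fcoeff v n" for n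
      using ev by (auto simp: e(2))
  qed (use e(1) in blast)
  \<comment> \<open>In this case \<open>L2_inner u v = - 1\<close>.\<close>
  have u_ne: "u \<noteq> 0" if "F = 0"
    using uv that by (auto simp: L2_inner_def zero_fun_def)
  have e_eq_0: "e = 0 \<longleftrightarrow> \<not> (\<exists>k. of_real (lam k) = \<mu>)"
  proof
    assume "e = 0"
    then have "fcoeff e n = 0" for n by (simp add: zero_fun_def fcoeff_const)
    then show "\<not> (\<exists>k. of_real (lam k) = \<mu>)" using e(2) by (metis zero_neq_one)
  next
    assume "\<not> (\<exists>k. of_real (lam k) = \<mu>)"
    then show "e = 0" using op_L0_unique[OF e(1) op_L0_zero] e(2) by (auto simp: zero_fun_def fcoeff_const)
  qed
  have repr: "\<exists>c d. y = (\<lambda>x. c * u x + d * e x) \<and> (F \<noteq> 0 \<longrightarrow> c = 0)" if y: "y \<in> E" for y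
  proof -
    obtain z where z: "(y, z) \<in> op_L0"
      and eq: "\<And>n. (of_real (lam n) - \<mu>) * fcoeff y n = - of_real \<alpha> * L2_inner y v * fcoeff v n"
      using y unfolding E_def eigenspace_iff[OF v] by blast
    define d where "d = (if \<exists>k. of_real (lam k) = \<mu> then fcoeff y (SOME k. of_real (lam k) = \<mu>) else 0)"
    have d: "fcoeff y n = d" if "of_real (lam n) = \<mu>" for n
    proof -
      have "of_real (lam k) = \<mu> \<longleftrightarrow> k = n" for k by (simp add: that[symmetric] point_inject)
      then show ?thesis by (simp add: d_def)
    qed
    have rep: "y = (\<lambda>x. - L2_inner y v * u x + d * e x)"
    proof (rule op_L0_unique[OF z op_L0_linear[OF u(1) e(1)]])
      fix n
      show "fcoeff y n = fcoeff (\<lambda>x. - L2_inner y v * u x + d * e x) n"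
      proof (cases "of_real (lam n) = \<mu>")
        case True
        then show ?thesis using d[OF True] by (simp only: fcoeff_combination[OF uL eL] e(2) u_res) simp
      next
        case False
        then have nz: "of_real (lam n) - \<mu> \<noteq> 0" by simp
        have "fcoeff y n = - L2_inner y v * (of_real \<alpha> * fcoeff v n / (of_real (lam n) - \<mu>))"
          using eq[of n] nz by (simp add: field_simps)
        then show ?thesis using False by (simp only: fcoeff_combination[OF uL eL] e(2) u(2)) simp
      qed
    qed
    show ?thesis
    proof (cases "F = 0")
      case True
      then show ?thesis using rep by blast
    next
      case F: False
      have "L2_inner y v = - L2_inner y v * L2_inner u v + d * L2_inner e v"
        using arg_cong[OF rep, of "\<lambda>f. L2_inner f v"]
        by (simp only: L2_inner_add_left[OF L2_scale[OF uL] L2_scale[OF eL] v] L2_inner_scale_left)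
      then have "L2_inner y v * F = d * L2_inner e v" by (simp add: uv algebra_simps)
      then have "of_real \<alpha> * L2_inner y v * F = d * (of_real \<alpha> * L2_inner e v)"
        by (simp add: algebra_simps)
      then have ac: "of_real \<alpha> * L2_inner y v = 0" using F ev by simp
      then have "L2_inner y v * fcoeff u n = 0" for n by (auto simp: u(2))
      then have "fcoeff y n = fcoeff (\<lambda>x. 0 * u x + d * e x) n" for n
        by (subst rep) (simp only: fcoeff_combination[OF uL eL], simp)
      then have "y = (\<lambda>x. 0 * u x + d * e x)"
        by (intro op_L0_unique[OF z op_L0_linear[OF u(1) e(1)]])
      then show ?thesis by blast
    qed
  qed
  \<comment> \<open>The resonant coefficient of \<open>u\<close> is 0 while \<open>e\<close> has no
    other nonzero coefficient, so a multiple of \<open>e\<close> equal to \<open>u\<close> would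
    force \<open>u = 0\<close>.\<close>
  have u_span: "u \<notin> fs.span {e}" if F: "F = 0"
  proof
    assume "u \<in> fs.span {e}"
    then obtain c where c: "u = (\<lambda>x. c * e x)" by (auto simp: fs.span_singleton fun_scale_def)
    have "fcoeff u n = c * fcoeff e n" for n
      using arg_cong[OF c, of "\<lambda>f. fcoeff f n"] unfolding fcoeff_scale .
    then have "fcoeff u n = 0" for n
      using u_res[of n] e(2)[of n] by (cases "of_real (lam n) = \<mu>") simp_all
    then have "u = (\<lambda>x. 0)" by (intro op_L0_unique[OF u(1) op_L0_zero]) (simp add: fcoeff_const)
    then show False using u_ne[OF F] by (simp add: zero_fun_def)
  qed
  define B where "B = (if F = 0 then {u} else {}) \<union> (if e = 0 then {} else {e})"
  have "B \<subseteq> E" unfolding B_def using u_E e_E by auto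
  moreover have "E \<subseteq> fs.span B"
  proof
    fix y assume "y \<in> E"
    then obtain c d where y: "y = (\<lambda>x. c * u x + d * e x)" "F \<noteq> 0 \<Longrightarrow> c = 0" using repr by blast
    \<comment> \<open>Inserting 0 does not change the span and lets \<open>e = 0\<close> be treated
      together with \<open>e \<noteq> 0\<close>.\<close>
    have "y \<in> fs.span (insert 0 B)"
    proof (cases "F = 0")
      case True
      then show ?thesis unfolding y(1) by (intro combination_in_span) (auto simp: B_def)
    next
      case False
      then have "y = (\<lambda>x. 0 * e x + d * e x)" using y by simp
      then show ?thesis by (simp only:) (intro combination_in_span; auto simp: B_def)
    qed
    then show "y \<in> fs.span B" by simp
  qed
  moreover have "fs.independent B"
  proof (cases "F = 0 \<and> e \<noteq> 0")
    case True
    then have "B = insert u {e}" by (auto simp: B_def)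
    moreover have "fs.independent (insert u {e})"
      using True u_span by (intro fs.independent_insertI fs.independent_empty) simp_all
    ultimately show ?thesis by simp
  qed (use u_ne fs.independent_empty in \<open>auto simp: B_def\<close>)
  moreover have "card B = (if F = 0 then 1 else 0) + (if \<exists>k. of_real (lam k) = \<mu> then 1 else 0)"
  proof -
    have "F = 0 \<Longrightarrow> u \<noteq> e" using u_span fs.span_base by blast
    then show ?thesis unfolding B_def using e_eq_0 by (cases "F = 0"; cases "e = 0") auto
  qed
  ultimately have "fs.dim E = (if F = 0 then 1 else 0) + (if \<exists>k. of_real (lam k) = \<mu> then 1 else 0)"
    by (rule fs.dim_unique)
  then show ?thesis by (simp add: multiplicity_of_def E_def F_def)
qed

text \<open>Outside the spectrum the eigenspace is trivial, so the counted spectrum carries the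
  multiplicities of all complex numbers.\<close>

lemma counted_spectrum_multiplicity:
  assumes v: "v \<in> L2" and w: "w \<in> L2"
    and eq: "counted_spectrum (op_L \<alpha> v) = counted_spectrum (op_L \<beta> w)"
  shows "multiplicity_of (op_L \<alpha> v) = multiplicity_of (op_L \<beta> w)"
proof
  fix \<mu>
  have zero: "multiplicity_of (op_L \<gamma> u) \<mu> = 0" if u: "u \<in> L2" and \<mu>: "\<mu> \<notin> spectrum (op_L \<gamma> u)" for \<gamma> u
  proof -
    have "\<forall>f\<in>L2. \<exists>!y. \<exists>z. (y, z) \<in> op_L \<gamma> u \<and> (AE x in I01. z x - \<mu> * y x = f x)"
      using \<mu> unfolding spectrum_def resolvent_set_def by simp
    \<comment> \<open>Unique solvability with right-hand side 0 leaves only the zero function in the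
      eigenspace.\<close>
    from bspec[OF this L2_zero] have "\<exists>!y. \<exists>z. (y, z) \<in> op_L \<gamma> u \<and> (AE x in I01. z x - \<mu> * y x = 0)" .
    then have "\<exists>!y. y \<in> eigenspace (op_L \<gamma> u) \<mu>" by (simp add: eigenspace_def)
    moreover have "0 \<in> eigenspace (op_L \<gamma> u) \<mu>"
      unfolding eigenspace_iff[OF u] using op_L0_zero
      by (auto simp: zero_fun_def fcoeff_const L2_inner_def)
    ultimately have "eigenspace (op_L \<gamma> u) \<mu> \<subseteq> fs.span {}" by auto
    then show ?thesis
      unfolding multiplicity_of_def using fs.dim_unique[OF empty_subsetI _ fs.independent_empty] by simp
  qed
  have spec: "\<mu> \<in> spectrum T \<longleftrightarrow> (\<mu>, multiplicity_of T \<mu>) \<in> counted_spectrum T" for T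
    by (auto simp: counted_spectrum_def)
  show "multiplicity_of (op_L \<alpha> v) \<mu> = multiplicity_of (op_L \<beta> w) \<mu>"
  proof (cases "\<mu> \<in> spectrum (op_L \<alpha> v)")
    case True
    then have "(\<mu>, multiplicity_of (op_L \<alpha> v) \<mu>) \<in> counted_spectrum (op_L \<beta> w)"
      using spec eq by blast
    then show ?thesis by (auto simp: counted_spectrum_def)
  next
    case False
    then have "\<mu> \<notin> spectrum (op_L \<beta> w)" using eq by (auto simp: counted_spectrum_def)
    then show ?thesis using zero[OF v False] zero[OF w] by simp
  qed
qed

text \<open>Multiplicity 0 at \<open>lam n\<close> characterises the poles, since an inactive
  \<open>lam n\<close> keeps its own eigenfunction. Away from the poles the summand for an
  unperturbed eigenvalue is the same for both operators, so equal multiplicities mean equal zeros of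
  the characteristic functions.\<close>

theorem counted_spectrum_determines_weights:
  assumes v: "v \<in> L2" and w: "w \<in> L2"
    and eq: "counted_spectrum (op_L \<alpha> v) = counted_spectrum (op_L \<beta> w)"
  shows "weights \<alpha> v = weights \<beta> w"
proof (rule char_fun_zeros_determine)
  note mult = counted_spectrum_multiplicity[OF v w eq]
  show "weights \<alpha> v summable_on UNIV" "weights \<beta> w summable_on UNIV"
    using weights_has_sum v w has_sum_imp_summable by blast+
  show "same_sign (weights \<alpha> v)" "same_sign (weights \<beta> w)" by (rule same_sign_weights)+
  have pole: "weights \<gamma> u n \<noteq> 0 \<longleftrightarrow> multiplicity_of (op_L \<gamma> u) (of_real (lam n)) = 0" if u: "u \<in> L2" for \<gamma> u n
  proof
    assume 0: "multiplicity_of (op_L \<gamma> u) (of_real (lam n)) = 0"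
    show "weights \<gamma> u n \<noteq> 0"
    proof
      assume "weights \<gamma> u n = 0"
      then have "of_real (lam k) \<noteq> (of_real (lam n) :: complex)" if "weights \<gamma> u k \<noteq> 0" for k
        using that by (auto simp: point_inject)
      then show False using multiplicity_formula[OF u, of \<gamma> "of_real (lam n)"] 0 by (auto split: if_splits)
    qed
  qed (rule multiplicity_at_pole[OF u])
  show supp: "weights \<alpha> v n = 0 \<longleftrightarrow> weights \<beta> w n = 0" for n
    using pole[OF v] pole[OF w] mult by metis
  fix \<mu> :: complex assume off: "\<And>n. weights \<alpha> v n \<noteq> 0 \<Longrightarrow> of_real (lam n) \<noteq> \<mu>"
  then have off': "\<And>n. weights \<beta> w n \<noteq> 0 \<Longrightarrow> of_real (lam n) \<noteq> \<mu>" using supp by blast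
  have mult_v: "multiplicity_of (op_L \<alpha> v) \<mu> =
      (if char_fun (weights \<alpha> v) \<mu> = 0 then 1 else 0) + (if \<exists>k. of_real (lam k) = \<mu> then 1 else 0)"
    by (rule multiplicity_formula[OF v]) (rule off)
  have mult_w: "multiplicity_of (op_L \<beta> w) \<mu> =
      (if char_fun (weights \<beta> w) \<mu> = 0 then 1 else 0) + (if \<exists>k. of_real (lam k) = \<mu> then 1 else 0)"
    by (rule multiplicity_formula[OF w]) (rule off')
  have "(if char_fun (weights \<alpha> v) \<mu> = 0 then 1 else 0 :: nat) = (if char_fun (weights \<beta> w) \<mu> = 0 then 1 else 0)"
    using fun_cong[OF mult, of \<mu>] unfolding mult_v mult_w by (rule add_right_imp_eq)
  then show "char_fun (weights \<alpha> v) \<mu> = 0 \<longleftrightarrow> char_fun (weights \<beta> w) \<mu> = 0"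
    by (simp split: if_splits)
qed

section \<open>Real coefficients of symmetric functions, and the parabola\<close>

text \<open>Replacing \<open>x\<close> by \<open>1 - x\<close> conjugates both \<open>v\<close> and
  \<open>fexp n\<close>, so the coefficient equals its own conjugate. The symmetry fails at most on
  a null set, which the integral ignores.\<close>

lemma fcoeff_real_of_symmetric:
  assumes v: "v \<in> L2" and sym: "AE x in I01. cnj (v (1 - x)) = v x"
  shows "fcoeff v n \<in> \<real>"
proof -
  define k where "k = (\<lambda>x. fexp n x * cnj (v x))"
  have ki: "integrable I01 k" unfolding k_def by (intro L2_inner_integrable fexp_L2 v)
  have vi: "integrable I01 (\<lambda>x. v x * cnj (fexp n x))" by (intro L2_inner_integrable fexp_L2 v)
  have "k integrable_on {0..1}"
    using integrable_on_lebesgue_on[OF ki] integrable_on_Icc_iff_Ioo by auto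
  then have "(k has_integral integral {0..1} k) {0..1}" by (rule integrable_integral)
  \<comment> \<open>The substitution is carried out as a reflection at 0 followed by a shift by
    1.\<close>
  then have "((\<lambda>x. k (- x)) has_integral integral {0..1} k) {-1..-0}"
    by (subst has_integral_reflect_real)
  from has_integral_shift_real_ivl[OF this, of "-1"]
  have k_int: "((\<lambda>x. k (1 - x)) has_integral integral {0..1} k) {0<..<1}"
    by (simp add: has_integral_Icc_iff_Ioo)
  have "AE x in lebesgue. x \<in> {0<..<1} \<longrightarrow> cnj (v (1 - x)) = v x"
    using sym by (simp add: AE_restrict_space_iff)
  then obtain N where "N \<in> null_sets lebesgue" and N': "{x. \<not> (x \<in> {0<..<1} \<longrightarrow> cnj (v (1 - x)) = v x)} \<subseteq> N"
    unfolding eventually_ae_filter by auto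
  then have N: "negligible N" by (simp add: negligible_iff_null_sets)
  have "((\<lambda>x. v x * cnj (fexp n x)) has_integral integral {0..1} k) {0<..<1}"
  proof (rule has_integral_spike[OF N _ k_int])
    fix x assume "x \<in> {0<..<1} - N"
    then have "cnj (v (1 - x)) = v x" using N' by blast
    moreover have "fexp n (1 - x) = cnj (fexp n x)"
    proof -
      have "fexp n (1 - x) * fexp n x = fexp n 1" by (simp add: fexp_def cis_mult algebra_simps)
      then have "fexp n (1 - x) * fexp n x = cnj (fexp n x) * fexp n x"
        by (simp add: cnj_fexp fexp_add)
      moreover have "fexp n x \<noteq> 0" using norm_fexp[of n x] by (metis norm_zero zero_neq_one)
      ultimately show ?thesis by simp
    qed
    ultimately show "v x * cnj (fexp n x) = k (1 - x)" by (simp add: k_def)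
  qed
  then have "fcoeff v n = integral {0..1} k"
    using vi by (simp add: fcoeff_def L2_inner_def lebesgue_integral_eq_integral integral_unique)
  also have "\<dots> = L2_inner (fexp n) v"
    using integral_I01_eq[OF ki] by (simp add: L2_inner_def k_def)
  also have "\<dots> = cnj (fcoeff v n)" by (simp add: fcoeff_def L2_inner_cnj)
  finally show ?thesis by (simp add: Reals_cnj_iff)
qed

text \<open>For \<open>n = 0\<close> the integral is \<open>1 / 12\<close>. Otherwise the parabola
  has equal end values but its derivative \<open>2 x - 1\<close> has not, and two integrations by
  parts give the coefficient \<open>2 / (2 pi n)^2\<close>.\<close>

lemma fcoeff_parabola_nonzero: "fcoeff (\<lambda>x. of_real ((x - 1 / 2)\<^sup>2)) n \<noteq> 0"
proof (cases "n = 0")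
  case True
  have "(\<integral>x. complex_of_real ((x - 1 / 2)\<^sup>2) \<partial>I01) = of_real (\<integral>x. (x - 1 / 2)\<^sup>2 \<partial>I01)"
    by (rule integral_complex_of_real)
  also have "(\<integral>x. (x - 1 / 2)\<^sup>2 \<partial>I01) = (1 - 1 / 2) ^ 3 / 3 - (0 - 1 / 2) ^ 3 / (3 :: real)"
    by (rule integral_I01_FTC)
      (auto intro!: continuous_intros derivative_eq_intros
        simp: has_real_derivative_iff_has_vector_derivative[symmetric] power2_eq_square)
  finally show ?thesis using True by (auto simp: fcoeff_def L2_inner_def power3_eq_cube)
next
  case False
  \<comment> \<open>\<open>g\<close> is \<open>2 x - 1\<close> on \<open>{0..1}\<close>, written as
    a primitive so that \<open>fcoeff_primitive\<close> applies to it.\<close>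
  define h g :: "real \<Rightarrow> complex" where "h = (\<lambda>x. of_real ((x - 1 / 2)\<^sup>2))" and "g = (\<lambda>x. - 1 + integral {0..x} (\<lambda>_. 2))"
  have J: "(\<lambda>x. integral {0..x} (\<lambda>_. 2 :: complex)) \<in> L2"
    by (intro L2_continuous continuous_on_primitive L2_const)
  have gL: "g \<in> L2" unfolding g_def by (intro L2_add J L2_const)
  have g_eq: "g x = of_real (2 * x - 1)" if "x \<ge> 0" for x using that by (simp add: g_def scaleR_conv_of_real)
  have h_int: "(g has_integral h x - h 0) {0..x}" if "x \<in> {0..1}" for x
  proof (rule fundamental_theorem_of_calculus)
    fix t assume t: "t \<in> {0..x}"
    have "((\<lambda>t. (t - 1 / 2)\<^sup>2) has_real_derivative (2 * t - 1)) (at t within {0..x})"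
      by (auto intro!: derivative_eq_intros)
    then have "((\<lambda>t. complex_of_real ((t - 1 / 2)\<^sup>2)) has_vector_derivative of_real (2 * t - 1)) (at t within {0..x})"
      by (intro has_vector_derivative_of_real) (simp add: has_real_derivative_iff_has_vector_derivative)
    moreover have "g t = of_real (2 * t - 1)" using g_eq[of t] t by simp
    ultimately show "(h has_vector_derivative g t) (at t within {0..x})" by (simp only: h_def)
  qed (use that in auto)
  have "sobolev_deriv h g"
    unfolding sobolev_deriv_iff
  proof (intro conjI ballI gL)
    fix x :: real assume "x \<in> {0..1}"
    then show "h x = h 0 + integral {0..x} g" using integral_unique[OF h_int] by simp
  qed
  moreover have "h 1 = h 0" by (simp add: h_def power2_eq_square)
  ultimately have "fcoeff g n = 2 * pi * of_int n * \<i> * fcoeff h n" by (rule fcoeff_sobolev_deriv)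
  moreover have "fcoeff g n = fcoeff (\<lambda>x. integral {0..x} (\<lambda>_. 2)) n"
    unfolding g_def using False by (simp only: fcoeff_add[OF L2_const J] fcoeff_const) simp
  moreover have "2 * pi * of_int n * \<i> * fcoeff (\<lambda>x. integral {0..x} (\<lambda>_. 2)) n = - 2"
    using fcoeff_primitive[OF L2_const[of 2], of n] False by (simp only: fcoeff_const) simp
  ultimately have "fcoeff h n \<noteq> 0" by auto
  then show ?thesis by (simp add: h_def)
qed

theorem potential_unique:
  fixes h :: "real \<Rightarrow> complex"
  assumes h: "h = (\<lambda>x. of_real ((x - 1 / 2)\<^sup>2))"
    and v: "v \<in> L2" "AE x in I01. cnj (v (1 - x)) = v x" "L2_norm v = 1"
    and w: "w \<in> L2" "AE x in I01. cnj (w (1 - x)) = w x" "L2_norm w = 1"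
    and eq: "counted_spectrum (op_L \<alpha> v) = counted_spectrum (op_L \<beta> w)"
    and eq_h: "counted_spectrum (op_L \<alpha> (\<lambda>x. v x + h x)) = counted_spectrum (op_L \<beta> (\<lambda>x. w x + h x))"
  shows "\<alpha> = \<beta>" "\<alpha> \<noteq> 0 \<Longrightarrow> AE x in I01. v x = w x"
proof -
  have p: "weights \<alpha> v = weights \<beta> w"
    by (rule counted_spectrum_determines_weights[OF v(1) w(1) eq])
  then show ab: "\<alpha> = \<beta>"
    using weights_has_sum[OF v(1), of \<alpha>] weights_has_sum[OF w(1), of \<beta>] v(3) w(3)
    by (auto dest: has_sum_unique)
  assume a: "\<alpha> \<noteq> 0"
  have hL: "h \<in> L2" unfolding h by (intro L2_continuous continuous_intros)
  have h_sym: "cnj (h (1 - x)) = h x" for x by (simp add: h power2_eq_square algebra_simps)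
  have ph: "weights \<alpha> (\<lambda>x. v x + h x) = weights \<beta> (\<lambda>x. w x + h x)"
    by (rule counted_spectrum_determines_weights[OF L2_add[OF v(1) hL] L2_add[OF w(1) hL] eq_h])
  have "fcoeff v n = fcoeff w n" for n
  proof -
    obtain a b c where abc: "fcoeff v n = of_real a" "fcoeff w n = of_real b" "fcoeff h n = of_real c"
      using fcoeff_real_of_symmetric[OF v(1,2), of n] fcoeff_real_of_symmetric[OF w(1,2), of n]
        fcoeff_real_of_symmetric[OF hL, of n] h_sym by (auto elim!: Reals_cases)
    have "c \<noteq> 0" using fcoeff_parabola_nonzero[of n] abc(3) by (auto simp: h)
    have "a\<^sup>2 = b\<^sup>2"
      using fun_cong[OF p, of n] \<open>\<alpha> \<noteq> 0\<close> by (simp add: ab[symmetric] weights_def abc)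
    moreover have "cmod (of_real a + of_real c) = \<bar>a + c\<bar>" "cmod (of_real b + of_real c) = \<bar>b + c\<bar>"
      by (simp_all flip: of_real_add)
    then have "(a + c)\<^sup>2 = (b + c)\<^sup>2"
      using fun_cong[OF ph, of n] \<open>\<alpha> \<noteq> 0\<close>
      by (simp add: ab[symmetric] weights_def fcoeff_add v(1) w(1) hL abc)
    \<comment> \<open>Subtracting \<open>a^2 = b^2\<close> from the shifted identity leaves only the
      cross terms; \<open>c \<noteq> 0\<close> then settles the sign.\<close>
    ultimately have "a * c = b * c" by (simp add: power2_sum)
    then show ?thesis using \<open>c \<noteq> 0\<close> abc by simp
  qed
  then show "AE x in I01. v x = w x" by (rule fcoeff_unique[OF v(1) w(1)])
qed

text \<open>Recovery means that one map from spectra to potentials works for all admissible pairs.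
  It is obtained from uniqueness by choice: the map picks some admissible pair with the given
  spectra. The claim about \<open>v\<close> is conditional because all \<open>v\<close> give the
  same operator when \<open>\<alpha> = 0\<close>.\<close>

theorem theorem5p6:
  fixes h :: "real \<Rightarrow> complex"
  assumes h: "h = (\<lambda>x. of_real ((x - 1 / 2)\<^sup>2))"
  shows "\<exists>recover :: (complex \<times> nat) set \<Rightarrow> (complex \<times> nat) set \<Rightarrow> (complex \<times> nat) set
            \<Rightarrow> real \<times> (real \<Rightarrow> complex).
     \<forall>(\<alpha> :: real) (v :: real \<Rightarrow> complex).
       v \<in> L2 \<longrightarrow> (AE x in I01. cnj (v (1 - x)) = v x) \<longrightarrow> L2_norm v = 1 \<longrightarrow>
       (\<exists>\<beta> w. recover (counted_spectrum op_L0) (counted_spectrum (op_L \<alpha> v))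
                  (counted_spectrum (op_L \<alpha> (\<lambda>x. v x + h x))) = (\<beta>, w) \<and>
          \<beta> = \<alpha> \<and> (\<alpha> \<noteq> 0 \<longrightarrow> (AE x in I01. w x = v x)))"
proof -
  define candidate where "candidate = (\<lambda>S1 S2 (\<beta>, w). w \<in> L2 \<and> (AE x in I01. cnj (w (1 - x)) = w x) \<and> L2_norm w = 1 \<and>
      counted_spectrum (op_L \<beta> w) = S1 \<and> counted_spectrum (op_L \<beta> (\<lambda>x. w x + h x)) = S2)"
  show ?thesis
  proof (intro exI[of _ "\<lambda>S0 S1 S2. SOME bw. candidate S1 S2 bw"] allI impI)
    fix \<alpha> :: real and v :: "real \<Rightarrow> complex"
    assume v: "v \<in> L2" "AE x in I01. cnj (v (1 - x)) = v x" "L2_norm v = 1"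
    define S1 S2 where "S1 = counted_spectrum (op_L \<alpha> v)" and "S2 = counted_spectrum (op_L \<alpha> (\<lambda>x. v x + h x))"
    obtain \<beta> w where bw: "(SOME bw. candidate S1 S2 bw) = (\<beta>, w)" by fastforce
    have "candidate S1 S2 (\<alpha>, v)" using v by (simp add: candidate_def S1_def S2_def)
    then have "candidate S1 S2 (\<beta>, w)" unfolding bw[symmetric] by (rule someI)
    then have w: "w \<in> L2" "AE x in I01. cnj (w (1 - x)) = w x" "L2_norm w = 1"
      and eq: "counted_spectrum (op_L \<beta> w) = counted_spectrum (op_L \<alpha> v)"
        "counted_spectrum (op_L \<beta> (\<lambda>x. w x + h x)) = counted_spectrum (op_L \<alpha> (\<lambda>x. v x + h x))"
      by (simp_all add: candidate_def S1_def S2_def)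
    have "\<beta> = \<alpha>" "\<beta> \<noteq> 0 \<Longrightarrow> AE x in I01. w x = v x"
      using potential_unique[OF h w v eq] by blast+
    then show "\<exists>\<beta> w. (SOME bw. candidate (counted_spectrum (op_L \<alpha> v)) (counted_spectrum (op_L \<alpha> (\<lambda>x. v x + h x))) bw) = (\<beta>, w) \<and>
        \<beta> = \<alpha> \<and> (\<alpha> \<noteq> 0 \<longrightarrow> (AE x in I01. w x = v x))"
      using bw unfolding S1_def S2_def by blast
  qed
qed

end
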